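(* Let $\Phi$ be the irreducible real affine root system of type $A_{2n-1}^{(2)}$. Then $\Psi\subseteq\Phi$ is a maximal closed subroot system whose gradient subroot system $\mathrm{Gr}(\Psi)$ is a proper semi-closed subroot system of $\mathring\Phi$ if and only if there exists a $\mathbb Z$-linear function $p:\mathcal D_n\to\mathbb Z$ such that $p_{\epsilon_s-\epsilon_t}$ and $p_{\epsilon_s+\epsilon_t}$ have different parity for each $1\le s\neq t\le n$ and $$\Psi=\Psi_p(A_{2n-1}^{(2)}):=\{\pm\epsilon_s\pm\epsilon_t+(p_{\pm\epsilon_s\pm\epsilon_t}+2r)\delta:1\le t\neq s\le n,\ r\in\mathbb Z\}.$$ The affine type of $\Psi_p(A_{2n-1}^{(2)})$ is $D_n^{(1)}$.
   Context: $n\ge3$; $\epsilon_1,\dots,\epsilon_n$ are orthonormal and $\delta$ is a vector linearly independent of them with $(\delta,\cdot)=0$. $$\Phi=\{\pm2\epsilon_i+2r\delta,\ \pm\epsilon_i\pm\epsilon_j+r\delta:r\in\mathbb Z,\ 1\le i\ne j\le n\},\qquad\mathring\Phi=\{\pm2\epsilon_i,\pm\epsilon_i\pm\epsilon_j:1\le i\ne j\le n\}$$ (type $C_n$; long roots $\pm2\epsilon_i$, short roots $\pm\epsilon_i\pm\epsilon_j$). $\mathcal D_n=\{\pm\epsilon_i\pm\epsilon_j:1\le i\neq j\le n\}$. A function $p:\mathcal D_n\to\mathbb Z$, $\alpha\mapsto p_\alpha$, is $\mathbb Z$-linear if it is the restriction of an additive homomorphism from the lattice spanned by $\mathcal D_n$.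 In the definition of $\Psi_p$ the signs in $\pm\epsilon_s\pm\epsilon_t$ and in the index of $p$ agree. With $\langle\beta,\alpha^\vee\rangle=2(\beta,\alpha)/(\alpha,\alpha)$ and $\mathbf s_\alpha(\beta)=\beta-\langle\beta,\alpha^\vee\rangle\alpha$, a non-empty subset $\Psi$ of $R$ ($R=\Phi$ or $\mathring\Phi$) is a subroot system if $\mathbf s_\alpha(\beta)\in\Psi$ for all $\alpha,\beta\in\Psi$; it is closed if $\alpha,\beta\in\Psi$, $\alpha+\beta\in R$ imply $\alpha+\beta\in\Psi$. A maximal closed subroot system of $R$ is a proper closed subroot system $\Psi$ such that $\Psi\subseteq\Delta\subsetneq R$ with $\Delta$ a closed subroot system implies $\Delta=\Psi$. The gradient is $\mathrm{Gr}(\Psi)=\{\alpha\in\mathring\Phi:\alpha+r\delta\in\Psi\text{ for some }r\}$. A subroot system $\mathring\Psi$ of $\mathring\Phi$ is semi-closed if it is not closed in $\mathring\Phi$ and, whenever $\alpha,\beta\in\mathring\Psi$ satisfy $\alpha+\beta\in\mathring\Phi\setminus\mathring\Psi$, the roots $\alpha,\beta$ are short and $\alpha+\beta$ is long. Type: an irreducible subroot system $\Psi$ is of type $X_k^{(t)}$ if there is a linear isomorphism from the real span of $\Psi$ onto the real span of the real affine root system of type $X_k^{(t)}$ mapping $\Psi$ onto it and preserving the integers $\langle\beta,\alpha^\vee\rangle$. The real roots of type $D_n^{(1)}$ are $\{\alpha+r\delta:\alpha\in D_n,r\in\mathbb Z\}$, with $D_3^{(1)}=A_3^{(1)}$. 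*)

theory Defs
  imports "HOL-Analysis.Analysis" "HOL-Computational_Algebra.Group_Closure"
begin

text \<open>
  Throughout, \<open>ip\<close> is a symmetric bilinear form on a real vector space, \<open>eps 1, \<dots>, eps n\<close> are the
  orthonormal vectors $\epsilon_1,\dots,\epsilon_n$ and \<open>\<delta>\<close> lies in the radical of \<open>ip\<close>. The form
  is therefore degenerate, so it is not the inner product of a \<open>real_inner\<close> type.
\<close>

definition pairing :: "('v \<Rightarrow> 'v \<Rightarrow> real) \<Rightarrow> 'v \<Rightarrow> 'v \<Rightarrow> real" where
  "pairing ip \<beta> \<alpha> = 2 * ip \<beta> \<alpha> / ip \<alpha> \<alpha>"

definition reflect :: "('v::real_vector \<Rightarrow> 'v \<Rightarrow> real) \<Rightarrow> 'v \<Rightarrow> 'v \<Rightarrow> 'v" where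
  "reflect ip \<alpha> \<beta> = \<beta> - pairing ip \<beta> \<alpha> *\<^sub>R \<alpha>"

definition subroot_system ::
    "('v::real_vector \<Rightarrow> 'v \<Rightarrow> real) \<Rightarrow> 'v set \<Rightarrow> 'v set \<Rightarrow> bool" where
  "subroot_system ip R \<Psi> \<longleftrightarrow>
     \<Psi> \<noteq> {} \<and> \<Psi> \<subseteq> R \<and> (\<forall>\<alpha>\<in>\<Psi>. \<forall>\<beta>\<in>\<Psi>. reflect ip \<alpha> \<beta> \<in> \<Psi>)"

definition closed_in_roots :: "'v::real_vector set \<Rightarrow> 'v set \<Rightarrow> bool" where
  "closed_in_roots R \<Psi> \<longleftrightarrow> (\<forall>\<alpha>\<in>\<Psi>. \<forall>\<beta>\<in>\<Psi>. \<alpha> + \<beta> \<in> R \<longrightarrow> \<alpha> + \<beta> \<in> \<Psi>)"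

definition closed_subroot_system ::
    "('v::real_vector \<Rightarrow> 'v \<Rightarrow> real) \<Rightarrow> 'v set \<Rightarrow> 'v set \<Rightarrow> bool" where
  "closed_subroot_system ip R \<Psi> \<longleftrightarrow> subroot_system ip R \<Psi> \<and> closed_in_roots R \<Psi>"

definition maximal_closed_subroot_system ::
    "('v::real_vector \<Rightarrow> 'v \<Rightarrow> real) \<Rightarrow> 'v set \<Rightarrow> 'v set \<Rightarrow> bool" where
  "maximal_closed_subroot_system ip R \<Psi> \<longleftrightarrow>
     closed_subroot_system ip R \<Psi> \<and> \<Psi> \<noteq> R \<and>
     (\<forall>\<Delta>. closed_subroot_system ip R \<Delta> \<and> \<Psi> \<subseteq> \<Delta> \<and> \<Delta> \<subset> R \<longrightarrow> \<Delta> = \<Psi>)"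

definition D_roots :: "(nat \<Rightarrow> 'v::real_vector) \<Rightarrow> nat \<Rightarrow> 'v set" where
  "D_roots eps n =
     {\<sigma> *\<^sub>R eps i + \<tau> *\<^sub>R eps j | \<sigma> \<tau> i j.
        \<sigma> \<in> {1, -1} \<and> \<tau> \<in> {1, -1} \<and> i \<in> {1..n} \<and> j \<in> {1..n} \<and> i \<noteq> j}"

definition C_long_roots :: "(nat \<Rightarrow> 'v::real_vector) \<Rightarrow> nat \<Rightarrow> 'v set" where
  "C_long_roots eps n = {\<sigma> *\<^sub>R (2 *\<^sub>R eps i) | \<sigma> i. \<sigma> \<in> {1, -1} \<and> i \<in> {1..n}}"

abbreviation C_short_roots :: "(nat \<Rightarrow> 'v::real_vector) \<Rightarrow> nat \<Rightarrow> 'v set" where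
  "C_short_roots \<equiv> D_roots"

definition C_roots :: "(nat \<Rightarrow> 'v::real_vector) \<Rightarrow> nat \<Rightarrow> 'v set" where
  "C_roots eps n = C_long_roots eps n \<union> C_short_roots eps n"

text \<open>The real roots of type $A_{2n-1}^{(2)}$: long roots are shifted by even multiples of \<open>\<delta>\<close> only.\<close>

definition A2_roots :: "(nat \<Rightarrow> 'v::real_vector) \<Rightarrow> 'v \<Rightarrow> nat \<Rightarrow> 'v set" where
  "A2_roots eps \<delta> n =
     {\<alpha> + of_int (2 * r) *\<^sub>R \<delta> | \<alpha> r. \<alpha> \<in> C_long_roots eps n} \<union>
     {\<alpha> + of_int r *\<^sub>R \<delta> | \<alpha> r. \<alpha> \<in> C_short_roots eps n}"

text \<open>The real roots of type $D_n^{(1)}$ (which is $A_3^{(1)}$ for $n = 3$).\<close>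

definition D1_roots :: "(nat \<Rightarrow> 'v::real_vector) \<Rightarrow> 'v \<Rightarrow> nat \<Rightarrow> 'v set" where
  "D1_roots eps \<delta> n = {\<alpha> + of_int r *\<^sub>R \<delta> | \<alpha> r. \<alpha> \<in> D_roots eps n}"

definition gradient :: "(nat \<Rightarrow> 'v::real_vector) \<Rightarrow> 'v \<Rightarrow> nat \<Rightarrow> 'v set \<Rightarrow> 'v set" where
  "gradient eps \<delta> n \<Psi> = {\<alpha> \<in> C_roots eps n. \<exists>r::int. \<alpha> + of_int r *\<^sub>R \<delta> \<in> \<Psi>}"

definition semi_closed ::
    "('v::real_vector \<Rightarrow> 'v \<Rightarrow> real) \<Rightarrow> (nat \<Rightarrow> 'v) \<Rightarrow> nat \<Rightarrow> 'v set \<Rightarrow> bool" where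
  "semi_closed ip eps n \<Psi> \<longleftrightarrow>
     subroot_system ip (C_roots eps n) \<Psi> \<and>
     \<not> closed_in_roots (C_roots eps n) \<Psi> \<and>
     (\<forall>\<alpha>\<in>\<Psi>. \<forall>\<beta>\<in>\<Psi>. \<alpha> + \<beta> \<in> C_roots eps n - \<Psi> \<longrightarrow>
        \<alpha> \<in> C_short_roots eps n \<and> \<beta> \<in> C_short_roots eps n \<and> \<alpha> + \<beta> \<in> C_long_roots eps n)"

text \<open>Only the values of \<open>p\<close> on \<open>D_roots eps n\<close> matter here and in \<open>Psi_p\<close>.\<close>

definition Z_linear :: "(nat \<Rightarrow> 'v::real_vector) \<Rightarrow> nat \<Rightarrow> ('v \<Rightarrow> int) \<Rightarrow> bool" where
  "Z_linear eps n p \<longleftrightarrow>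
     (\<exists>f. (\<forall>x\<in>group_closure (D_roots eps n). \<forall>y\<in>group_closure (D_roots eps n).
             f (x + y) = f x + f y) \<and>
          (\<forall>\<alpha>\<in>D_roots eps n. p \<alpha> = f \<alpha>))"

definition parity_condition :: "(nat \<Rightarrow> 'v::real_vector) \<Rightarrow> nat \<Rightarrow> ('v \<Rightarrow> int) \<Rightarrow> bool" where
  "parity_condition eps n p \<longleftrightarrow>
     (\<forall>s\<in>{1..n}. \<forall>t\<in>{1..n}. s \<noteq> t \<longrightarrow>
        even (p (eps s - eps t)) \<noteq> even (p (eps s + eps t)))"

definition Psi_p ::
    "(nat \<Rightarrow> 'v::real_vector) \<Rightarrow> 'v \<Rightarrow> nat \<Rightarrow> ('v \<Rightarrow> int) \<Rightarrow> 'v set" where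
  "Psi_p eps \<delta> n p = {\<alpha> + of_int (p \<alpha> + 2 * r) *\<^sub>R \<delta> | \<alpha> r. \<alpha> \<in> D_roots eps n}"

definition irreducible_roots :: "('v \<Rightarrow> 'v \<Rightarrow> real) \<Rightarrow> 'v set \<Rightarrow> bool" where
  "irreducible_roots ip \<Psi> \<longleftrightarrow>
     \<Psi> \<noteq> {} \<and>
     \<not> (\<exists>A B. A \<noteq> {} \<and> B \<noteq> {} \<and> A \<inter> B = {} \<and> A \<union> B = \<Psi> \<and>
          (\<forall>\<alpha>\<in>A. \<forall>\<beta>\<in>B. ip \<alpha> \<beta> = 0))"

text \<open>
  \<open>Q\<close> is the set of real roots of the reference affine root system. A linear map defined only on
  \<open>span \<Psi>\<close> always extends to the whole space, so the isomorphism is taken to be the restriction of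
  a globally linear \<open>f\<close>.
\<close>

definition has_type_of ::
    "('v::real_vector \<Rightarrow> 'v \<Rightarrow> real) \<Rightarrow> 'v set \<Rightarrow> 'v set \<Rightarrow> 'v set \<Rightarrow> bool" where
  "has_type_of ip R \<Psi> Q \<longleftrightarrow>
     subroot_system ip R \<Psi> \<and> irreducible_roots ip \<Psi> \<and>
     (\<exists>f. linear f \<and> bij_betw f (span \<Psi>) (span Q) \<and> f ` \<Psi> = Q \<and>
        (\<forall>\<alpha>\<in>\<Psi>. \<forall>\<beta>\<in>\<Psi>. pairing ip (f \<beta>) (f \<alpha>) = pairing ip \<beta> \<alpha>))"

end

theory Submission
  imports Defs
begin

text \<open>
  The form turns an additive function on the lattice of $D_n$ into a vector \<open>w\<close> with
  \<open>p \<alpha> = ip \<alpha> w\<close>. The parity condition says precisely that every coordinate of \<open>w\<close> lies in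
  $1/2 + \mathbf{Z}$. The linear function \<open>offset w\<close>, which sends \<open>\<alpha> + t\<delta>\<close> to \<open>t - ip \<alpha> w\<close>, is then an
  integer on all affine roots and odd on the long ones, so \<open>\<Psi>\<^sub>p\<close> is the set of roots with even
  offset: the kernel, within the root system, of a homomorphism to \<open>\<int>/2\<close>. Such a kernel is
  a closed subroot system for a trivial reason (\<open>mod2_kernel_closed_subroot_system\<close>).

  It is maximal because the roots of odd offset are connected to each other by adding roots of even
  offset (\<open>even_part_no_intermediate\<close>). Its gradient is \<open>D_roots\<close>, which is semi-closed.

  Conversely, let \<open>\<Psi>\<close> be maximal with semi-closed gradient. Some \<open>x + y\<close>, \<open>x - y\<close> belong to the
  gradient and \<open>2x\<close> does not. If the coordinates were split by the gradient into several blocks,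
  the roots respecting the block of \<open>x\<close> would again be a mod 2 kernel, strictly between \<open>\<Psi>\<close> and the
  whole system (\<open>maximal_imp_units_linked\<close>). So there is only one block, and conjugation by
  reflections forces the gradient to be exactly \<open>D_roots\<close> (\<open>gradient_is_D\<close>). Absence of long roots
  fixes the parity of the \<open>\<delta>\<close>-coefficients over each short root, and closedness makes this parity
  additive. That gives a vector \<open>w\<close> with \<open>\<Psi>\<close> inside the corresponding \<open>\<Psi>\<^sub>p\<close> (\<open>subset_even_part\<close>),
  and maximality yields equality.

  For the affine type, shifting each \<open>\<delta>\<close>-coefficient by \<open>ip \<alpha> w\<close> and halving it is a linear
  isomorphism onto the real roots of $D_n^{(1)}$ that does not change the form (\<open>even_part_type\<close>).
\<close>

section \<open>Roots through signed unit vectors\<close>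

text \<open>
  The functional \<open>d\<close> reads off the coefficient of \<open>\<delta>\<close>. The form cannot do this, because \<open>\<delta>\<close>
  lies in its radical; \<open>d\<close> exists because \<open>\<delta>\<close> is independent of the \<open>eps i\<close>.
\<close>

locale affine_C_frame =
  fixes ip :: "'v::real_vector \<Rightarrow> 'v \<Rightarrow> real"
    and eps :: "nat \<Rightarrow> 'v" and \<delta> :: 'v and n :: nat and d :: "'v \<Rightarrow> real"
  assumes n: "n \<ge> 3"
    and ip_bilinear: "bilinear ip"
    and ip_sym: "\<And>x y. ip x y = ip y x"
    and orthonormal:
      "\<And>i j. i \<in> {1..n} \<Longrightarrow> j \<in> {1..n} \<Longrightarrow> ip (eps i) (eps j) = (if i = j then 1 else 0)"
    and delta_isotropic: "\<And>x. ip \<delta> x = 0"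
    and d_linear: "linear d"
    and d_delta: "d \<delta> = 1"
    and d_eps: "\<And>i. i \<in> {1..n} \<Longrightarrow> d (eps i) = 0"
begin

abbreviation D where "D \<equiv> D_roots eps n"
abbreviation L where "L \<equiv> C_long_roots eps n"
abbreviation C where "C \<equiv> C_roots eps n"
abbreviation \<Phi> where "\<Phi> \<equiv> A2_roots eps \<delta> n"

lemma ip_delta_right: "ip x \<delta> = 0"
  using delta_isotropic ip_sym by metis

lemmas ip_simps =
  bilinear_ladd[OF ip_bilinear] bilinear_radd[OF ip_bilinear]
  bilinear_lsub[OF ip_bilinear] bilinear_rsub[OF ip_bilinear]
  bilinear_lmul[OF ip_bilinear] bilinear_rmul[OF ip_bilinear]
  bilinear_lneg[OF ip_bilinear] bilinear_rneg[OF ip_bilinear]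
  bilinear_lzero[OF ip_bilinear] bilinear_rzero[OF ip_bilinear]
  delta_isotropic ip_delta_right

lemmas d_simps =
  linear_add[OF d_linear] linear_diff[OF d_linear] linear_scale[OF d_linear]
  linear_neg[OF d_linear] linear_0[OF d_linear] d_delta

text \<open>
  In terms of these vectors the short roots are the \<open>u + v\<close> with \<open>u\<close> orthogonal to \<open>v\<close>, and the
  long roots are the \<open>2u\<close>. No signs or indices have to be carried around.
\<close>

definition signed_units :: "'v set" where
  "signed_units = {u. \<exists>i\<in>{1..n}. u = eps i \<or> u = - eps i}"

abbreviation E where "E \<equiv> signed_units"

lemma E_neg: "u \<in> E \<Longrightarrow> - u \<in> E"
  unfolding signed_units_def by auto

lemma E_eps: "i \<in> {1..n} \<Longrightarrow> eps i \<in> E"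
  unfolding signed_units_def by auto

lemma d_E: "u \<in> E \<Longrightarrow> d u = 0"
  unfolding signed_units_def by (auto simp: d_simps d_eps)

lemma ip_E_self: "u \<in> E \<Longrightarrow> ip u u = 1"
  unfolding signed_units_def by (auto simp: ip_simps orthonormal)

lemma ip_E_cases:
  assumes "u \<in> E" "v \<in> E"
  obtains "v = u" "ip u v = 1" | "v = - u" "ip u v = - 1" | "ip u v = 0"
proof -
  from assms obtain i j where "i \<in> {1..n}" "j \<in> {1..n}" "u = eps i \<or> u = - eps i"
      "v = eps j \<or> v = - eps j"
    unfolding signed_units_def by auto
  then show thesis
    using that by (cases "i = j") (auto simp: ip_simps orthonormal)
qed

lemma ip_E_Ints: "u \<in> E \<Longrightarrow> v \<in> E \<Longrightarrow> ip u v \<in> \<int>"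
  by (erule (1) ip_E_cases) auto

text \<open>
  This is where $n \<ge> 3$ enters: two signed unit vectors always leave a third coordinate free.
\<close>

lemma perp_third:
  assumes "u \<in> E" "v \<in> E"
  obtains z where "z \<in> E" "ip u z = 0" "ip v z = 0"
proof -
  from assms obtain i j where ij: "i \<in> {1..n}" "j \<in> {1..n}" "u = eps i \<or> u = - eps i"
      "v = eps j \<or> v = - eps j"
    unfolding signed_units_def by auto
  obtain k where k: "k \<in> {1, 2, 3::nat}" "k \<noteq> i" "k \<noteq> j"
  proof -
    have "1 \<noteq> i \<and> 1 \<noteq> j \<or> 2 \<noteq> i \<and> 2 \<noteq> j \<or> 3 \<noteq> i \<and> 3 \<noteq> j" by arith
    then show thesis using that by auto
  qed
  then have kn: "k \<in> {1..n}" using n by auto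
  show thesis
    by (rule that[OF E_eps[OF kn]])
      (use ij k(2,3) kn in \<open>auto simp: ip_simps orthonormal\<close>)
qed

lemma D_iff: "\<alpha> \<in> D \<longleftrightarrow> (\<exists>u\<in>E. \<exists>v\<in>E. ip u v = 0 \<and> \<alpha> = u + v)"
proof
  assume "\<alpha> \<in> D"
  then obtain \<sigma> \<tau> :: real and i j where st: "\<sigma> \<in> {1, -1}" "\<tau> \<in> {1, -1}"
    and ij: "i \<in> {1..n}" "j \<in> {1..n}" "i \<noteq> j" and \<alpha>: "\<alpha> = \<sigma> *\<^sub>R eps i + \<tau> *\<^sub>R eps j"
    unfolding D_roots_def by blast
  have "\<sigma> *\<^sub>R eps i \<in> E" "\<tau> *\<^sub>R eps j \<in> E" using st ij unfolding signed_units_def by auto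
  moreover have "ip (\<sigma> *\<^sub>R eps i) (\<tau> *\<^sub>R eps j) = 0" using ij by (simp add: ip_simps orthonormal)
  ultimately show "\<exists>u\<in>E. \<exists>v\<in>E. ip u v = 0 \<and> \<alpha> = u + v" using \<alpha> by blast
next
  assume "\<exists>u\<in>E. \<exists>v\<in>E. ip u v = 0 \<and> \<alpha> = u + v"
  then obtain u v where uv: "u \<in> E" "v \<in> E" "ip u v = 0" "\<alpha> = u + v" by blast
  obtain \<sigma> :: real and i where i: "i \<in> {1..n}" "\<sigma> \<in> {1, -1}" "u = \<sigma> *\<^sub>R eps i"
    using uv(1) unfolding signed_units_def by force
  obtain \<tau> :: real and j where j: "j \<in> {1..n}" "\<tau> \<in> {1, -1}" "v = \<tau> *\<^sub>R eps j"
    using uv(2) unfolding signed_units_def by force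
  have "i \<noteq> j" using uv(3) i j by (auto simp: ip_simps orthonormal)
  then show "\<alpha> \<in> D" unfolding D_roots_def using uv(4) i j by blast
qed

lemma D_I: "u \<in> E \<Longrightarrow> v \<in> E \<Longrightarrow> ip u v = 0 \<Longrightarrow> u + v \<in> D"
  unfolding D_iff by blast

lemma L_iff: "\<alpha> \<in> L \<longleftrightarrow> (\<exists>u\<in>E. \<alpha> = 2 *\<^sub>R u)"
  unfolding C_long_roots_def signed_units_def by force

lemma C_iff: "\<alpha> \<in> C \<longleftrightarrow> \<alpha> \<in> L \<or> \<alpha> \<in> D"
  unfolding C_roots_def by blast

lemma C_cases:
  assumes "\<alpha> \<in> C"
  obtains (short) u v where "u \<in> E" "v \<in> E" "ip u v = 0" "\<alpha> = u + v"
    | (long) u where "u \<in> E" "\<alpha> = 2 *\<^sub>R u"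
  using assms unfolding C_roots_def D_iff L_iff Un_iff by blast

lemma short_in_C: "u \<in> E \<Longrightarrow> v \<in> E \<Longrightarrow> ip u v = 0 \<Longrightarrow> u + v \<in> C"
  unfolding C_roots_def Un_iff D_iff by blast

lemma long_in_C: "u \<in> E \<Longrightarrow> 2 *\<^sub>R u \<in> C"
  unfolding C_roots_def Un_iff L_iff by blast

lemma norm_short: "\<alpha> \<in> D \<Longrightarrow> ip \<alpha> \<alpha> = 2"
  unfolding D_iff using ip_sym by (auto simp: ip_simps ip_E_self)

lemma norm_long: "\<alpha> \<in> L \<Longrightarrow> ip \<alpha> \<alpha> = 4"
  unfolding L_iff by (auto simp: ip_simps ip_E_self)

lemma D_not_L: "\<alpha> \<in> D \<Longrightarrow> \<alpha> \<notin> L"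
  using norm_short norm_long by force

lemma d_C: "\<alpha> \<in> C \<Longrightarrow> d \<alpha> = 0"
  by (erule C_cases) (auto simp: d_simps d_E)

lemma lift_eqD:
  assumes "\<alpha> \<in> C" "\<beta> \<in> C" "\<alpha> + of_int r *\<^sub>R \<delta> = \<beta> + of_int s *\<^sub>R \<delta>"
  shows "\<alpha> = \<beta> \<and> r = s"
proof -
  have "d (\<alpha> + of_int r *\<^sub>R \<delta>) = d (\<beta> + of_int s *\<^sub>R \<delta>)" using assms(3) by simp
  then have "r = s" by (simp add: d_simps d_C assms(1,2))
  then show ?thesis using assms(3) by simp
qed

lemma lift_in_Phi_iff:
  assumes "\<alpha> \<in> C"
  shows "\<alpha> + of_int r *\<^sub>R \<delta> \<in> \<Phi> \<longleftrightarrow> \<alpha> \<in> D \<or> even r"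
proof
  assume "\<alpha> + of_int r *\<^sub>R \<delta> \<in> \<Phi>"
  then consider (l) \<beta> s where "\<beta> \<in> L" "\<alpha> + of_int r *\<^sub>R \<delta> = \<beta> + of_int (2 * s) *\<^sub>R \<delta>"
    | (s) \<beta> s where "\<beta> \<in> D" "\<alpha> + of_int r *\<^sub>R \<delta> = \<beta> + of_int s *\<^sub>R \<delta>"
    unfolding A2_roots_def by blast
  then show "\<alpha> \<in> D \<or> even r"
  proof cases
    case l
    then have "r = 2 * s" using lift_eqD[OF assms _ l(2)] C_roots_def by blast
    then show ?thesis by simp
  next
    case s
    then show ?thesis using lift_eqD[OF assms _ s(2)] C_roots_def by blast
  qed
next
  assume a: "\<alpha> \<in> D \<or> even r"
  show "\<alpha> + of_int r *\<^sub>R \<delta> \<in> \<Phi>"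
  proof (cases "\<alpha> \<in> D")
    case True then show ?thesis unfolding A2_roots_def by blast
  next
    case False
    then obtain s where "\<alpha> \<in> L" "r = 2 * s" using a assms C_iff evenE by metis
    then show ?thesis unfolding A2_roots_def by blast
  qed
qed

lemma short_in_Phi: "u \<in> E \<Longrightarrow> v \<in> E \<Longrightarrow> ip u v = 0 \<Longrightarrow> u + v + of_int t *\<^sub>R \<delta> \<in> \<Phi>"
  using lift_in_Phi_iff short_in_C D_iff by blast

lemma long_in_Phi: "u \<in> E \<Longrightarrow> even t \<Longrightarrow> 2 *\<^sub>R u + of_int t *\<^sub>R \<delta> \<in> \<Phi>"
  using lift_in_Phi_iff long_in_C by blast

lemma Phi_cases:
  assumes "\<gamma> \<in> \<Phi>"
  obtains (short) u v t where "u \<in> E" "v \<in> E" "ip u v = 0" "\<gamma> = u + v + of_int t *\<^sub>R \<delta>"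
    | (long) u t where "u \<in> E" "even t" "\<gamma> = 2 *\<^sub>R u + of_int t *\<^sub>R \<delta>"
proof -
  from assms consider (l) \<beta> s where "\<beta> \<in> L" "\<gamma> = \<beta> + of_int (2 * s) *\<^sub>R \<delta>"
    | (s) \<beta> s where "\<beta> \<in> D" "\<gamma> = \<beta> + of_int s *\<^sub>R \<delta>"
    unfolding A2_roots_def by blast
  then show thesis
  proof cases
    case l then show thesis unfolding L_iff using long[of _ "2 * s"] by auto
  next
    case s then show thesis unfolding D_iff using short by auto
  qed
qed

lemma Phi_lift:
  assumes "\<gamma> \<in> \<Phi>"
  obtains \<alpha> t where "\<alpha> \<in> C" "\<gamma> = \<alpha> + of_int t *\<^sub>R \<delta>" "\<alpha> \<in> D \<or> even t"
  using assms
proof (cases rule: Phi_cases)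
  case short
  then show ?thesis using that short_in_C D_iff by blast
next
  case long
  then show ?thesis using that long_in_C by blast
qed

section \<open>Reflections of the twisted affine system\<close>

lemma reflect_add: "reflect ip \<alpha> (x + y) = reflect ip \<alpha> x + reflect ip \<alpha> y"
  by (simp add: reflect_def pairing_def ip_simps algebra_simps add_divide_distrib)

lemma reflect_scale: "reflect ip \<alpha> (c *\<^sub>R x) = c *\<^sub>R reflect ip \<alpha> x"
  by (simp add: reflect_def pairing_def ip_simps algebra_simps)

lemma reflect_isometry:
  assumes "ip \<alpha> \<alpha> \<noteq> 0"
  shows "ip (reflect ip \<alpha> x) (reflect ip \<alpha> y) = ip x y"
  using assms ip_sym[of \<alpha> x] ip_sym[of \<alpha> y]
  by (simp add: reflect_def pairing_def ip_simps field_simps)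

lemma reflect_lift:
  "reflect ip (\<alpha> + a *\<^sub>R \<delta>) (\<beta> + b *\<^sub>R \<delta>) =
     reflect ip \<alpha> \<beta> + (b - pairing ip \<beta> \<alpha> * a) *\<^sub>R \<delta>"
  by (simp add: reflect_def pairing_def ip_simps algebra_simps)

lemma reflect_self: "ip \<alpha> \<alpha> \<noteq> 0 \<Longrightarrow> reflect ip \<alpha> \<alpha> = - \<alpha>"
  by (simp add: reflect_def pairing_def scaleR_2)

lemma norm_C: "\<alpha> \<in> C \<Longrightarrow> ip \<alpha> \<alpha> \<noteq> 0"
  using norm_short norm_long C_roots_def by force

lemma pairing_short: "\<alpha> \<in> D \<Longrightarrow> pairing ip \<beta> \<alpha> = ip \<beta> \<alpha>"
  by (simp add: pairing_def norm_short)

lemma pairing_long: "u \<in> E \<Longrightarrow> pairing ip \<beta> (2 *\<^sub>R u) = ip \<beta> u"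
  by (simp add: pairing_def ip_simps ip_E_self)

text \<open>
  A reflection in a root of type $C_n$ permutes the signed unit vectors; since it is an isometry, it
  therefore permutes the short roots and the long roots.
\<close>

lemma reflect_E:
  assumes "\<alpha> \<in> C" "z \<in> E"
  shows "reflect ip \<alpha> z \<in> E"
  using assms(1)
proof (cases rule: C_cases)
  case (short u v)
  have p: "pairing ip z (u + v) = ip z u + ip z v"
    using pairing_short[of "u + v" z] D_iff[of "u + v"] short(1-3) by (auto simp: ip_simps)
  have r: "reflect ip \<alpha> z = z - (ip z u + ip z v) *\<^sub>R (u + v)"
    unfolding short(4) reflect_def p ..
  have vu: "ip v u = 0" using short ip_sym by metis
  from ip_E_cases[OF assms(2) short(1)] show ?thesis
  proof cases
    case 1 then show ?thesis unfolding r using short(1-3) vu E_neg by simp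
  next
    case 2
    then have "ip z v = 0" using short(3) by (simp add: ip_simps)
    then show ?thesis unfolding r using short(1-3) 2 by simp
  next
    case 3
    from ip_E_cases[OF assms(2) short(2)] show ?thesis
      unfolding r using short(1-3) 3 E_neg assms(2) by cases simp_all
  qed
next
  case (long u)
  have r: "reflect ip \<alpha> z = z - (2 * ip z u) *\<^sub>R u"
    unfolding long(2) reflect_def pairing_long[OF long(1)] by simp
  from ip_E_cases[OF assms(2) long(1)] show ?thesis
    unfolding r using long(1) E_neg assms(2) by cases (simp_all add: algebra_simps scaleR_2)
qed

lemma reflect_short:
  assumes "\<alpha> \<in> C" "\<beta> \<in> D" shows "reflect ip \<alpha> \<beta> \<in> D"
proof -
  from assms(2) obtain u v where "u \<in> E" "v \<in> E" "ip u v = 0" "\<beta> = u + v"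
    unfolding D_iff by blast
  then show ?thesis unfolding D_iff
    using reflect_E[OF assms(1)] reflect_isometry[OF norm_C[OF assms(1)]] reflect_add by metis
qed

lemma reflect_long:
  assumes "\<alpha> \<in> C" "\<beta> \<in> L" shows "reflect ip \<alpha> \<beta> \<in> L"
  using assms unfolding L_iff using reflect_E[OF assms(1)] reflect_scale by metis

lemma pairing_Ints:
  assumes "\<alpha> \<in> C" "\<beta> \<in> C" shows "pairing ip \<beta> \<alpha> \<in> \<int>"
  using assms(1)
proof (cases rule: C_cases)
  case (short u v)
  then have "pairing ip \<beta> \<alpha> = ip \<beta> u + ip \<beta> v"
    using pairing_short[of \<alpha> \<beta>] D_iff[of \<alpha>] by (auto simp: ip_simps)
  with assms(2) short show ?thesis
    by (cases rule: C_cases) (auto simp: ip_simps ip_E_Ints)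
next
  case (long u)
  with assms(2) show ?thesis
    by (cases rule: C_cases) (auto simp: ip_simps pairing_long ip_E_Ints)
qed

text \<open>
  The evenness is what makes the twisted root system reflection-stable: a reflection in
  \<open>\<alpha> + a\<delta>\<close> changes the \<open>\<delta>\<close>-coefficient of a long root by a multiple of this integer, so that the
  coefficient stays even.
\<close>

lemma pairing_long_short_even:
  assumes "\<alpha> \<in> D" "\<beta> \<in> L" shows "pairing ip \<beta> \<alpha> / 2 \<in> \<int>"
  using assms pairing_short[OF assms(1)] unfolding D_iff L_iff
  by (auto simp: ip_simps ip_E_Ints add_divide_distrib)

lemma Phi_reflect:
  assumes "\<gamma> \<in> \<Phi>" "\<eta> \<in> \<Phi>"
  shows "reflect ip \<gamma> \<eta> \<in> \<Phi>" and "pairing ip \<eta> \<gamma> \<in> \<int>"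
proof -
  obtain \<alpha> a where a: "\<alpha> \<in> C" "\<gamma> = \<alpha> + of_int a *\<^sub>R \<delta>" "\<alpha> \<in> D \<or> even a"
    using Phi_lift[OF assms(1)] by metis
  obtain \<beta> b where b: "\<beta> \<in> C" "\<eta> = \<beta> + of_int b *\<^sub>R \<delta>" "\<beta> \<in> D \<or> even b"
    using Phi_lift[OF assms(2)] by metis
  obtain m :: int where m: "pairing ip \<beta> \<alpha> = of_int m"
    using pairing_Ints[OF a(1) b(1)] by (auto elim: Ints_cases)
  have "pairing ip \<eta> \<gamma> = pairing ip \<beta> \<alpha>" by (simp add: a b pairing_def ip_simps)
  then show "pairing ip \<eta> \<gamma> \<in> \<int>" using m by simp
  have eq: "reflect ip \<gamma> \<eta> = reflect ip \<alpha> \<beta> + of_int (b - m * a) *\<^sub>R \<delta>"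
    unfolding a b reflect_lift m by simp
  show "reflect ip \<gamma> \<eta> \<in> \<Phi>"
  proof (cases "\<beta> \<in> D")
    case True
    then show ?thesis unfolding eq
      using reflect_short[OF a(1)] lift_in_Phi_iff C_roots_def by blast
  next
    case False
    then have bL: "\<beta> \<in> L" "even b" using b C_roots_def by auto
    have "even (m * a)"
    proof (cases "\<alpha> \<in> D")
      case True
      then obtain k :: int where "pairing ip \<beta> \<alpha> / 2 = of_int k"
        using pairing_long_short_even[OF _ bL(1)] Ints_cases by metis
      then have "real_of_int m = of_int (2 * k)" using m by simp
      then show ?thesis unfolding of_int_eq_iff by simp
    qed (use a in auto)
    then show ?thesis unfolding eq
      using reflect_long[OF a(1) bL(1)] bL(2) by (simp add: lift_in_Phi_iff C_iff del: of_int_diff)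
  qed
qed

text \<open>
  The single source of closed subroot systems here. Closure under sums is additivity of \<open>h\<close>;
  closure under reflections holds because a reflection subtracts an integral multiple. Both the
  systems \<open>\<Psi>\<^sub>p\<close> and the systems used to refute maximality of other candidates have this form.
\<close>

lemma mod2_kernel_closed_subroot_system:
  assumes h: "linear (h :: 'v \<Rightarrow> real)"
    and ne: "\<gamma>\<^sub>0 \<in> \<Phi>" "h \<gamma>\<^sub>0 / 2 \<in> \<int>"
  shows "closed_subroot_system ip \<Phi> {\<gamma> \<in> \<Phi>. h \<gamma> / 2 \<in> \<int>}"
  unfolding closed_subroot_system_def subroot_system_def closed_in_roots_def
proof (intro conjI ballI impI)
  fix \<alpha> \<beta> assume a: "\<alpha> \<in> {\<gamma> \<in> \<Phi>. h \<gamma> / 2 \<in> \<int>}" "\<beta> \<in> {\<gamma> \<in> \<Phi>. h \<gamma> / 2 \<in> \<int>}"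
  have eq: "h (reflect ip \<alpha> \<beta>) / 2 = h \<beta> / 2 - pairing ip \<beta> \<alpha> * (h \<alpha> / 2)"
    by (simp add: reflect_def linear_diff[OF h] linear_scale[OF h] field_simps)
  show "reflect ip \<alpha> \<beta> \<in> {\<gamma> \<in> \<Phi>. h \<gamma> / 2 \<in> \<int>}"
    unfolding mem_Collect_eq eq using a Phi_reflect[of \<alpha> \<beta>] by (intro conjI Ints_diff Ints_mult) auto
  assume "\<alpha> + \<beta> \<in> \<Phi>"
  then show "\<alpha> + \<beta> \<in> {\<gamma> \<in> \<Phi>. h \<gamma> / 2 \<in> \<int>}"
    using a by (simp add: linear_add[OF h] add_divide_distrib)
qed (use ne in auto)

section \<open>Connectedness of orthogonal pairs\<close>

text \<open>
  Connectedness of the orthogonal pairs when one member at a time is replaced by a vector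
  orthogonal to both members. The pair \<open>(u, -v)\<close> is reached from \<open>(u, v)\<close> by way of a third
  vector. This drives both the maximality and the irreducibility of \<open>\<Psi>\<^sub>p\<close>.
\<close>

lemma perp_pairs_connected:
  assumes sym: "\<And>u v. Q u v \<Longrightarrow> Q v u"
    and step: "\<And>u v z. u \<in> E \<Longrightarrow> v \<in> E \<Longrightarrow> z \<in> E \<Longrightarrow> ip u v = 0 \<Longrightarrow> ip u z = 0 \<Longrightarrow>
      ip v z = 0 \<Longrightarrow> Q u v \<Longrightarrow> Q u z"
    and start: "u\<^sub>0 \<in> E" "v\<^sub>0 \<in> E" "ip u\<^sub>0 v\<^sub>0 = 0" "Q u\<^sub>0 v\<^sub>0"
    and ab: "a \<in> E" "b \<in> E" "ip a b = 0"
  shows "Q a b"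
proof -
  have step': "Q u z" if u: "u \<in> E" "v \<in> E" "z \<in> E" "ip u v = 0" "ip u z = 0" "Q u v" for u v z
    using u(2,3)
  proof (cases rule: ip_E_cases)
    case 2
    obtain t where t: "t \<in> E" "ip u t = 0" "ip v t = 0"
      using perp_third[OF u(1,2)] by metis
    have "Q u t" using step[OF u(1,2) t(1) u(4) t(2,3) u(6)] .
    then show ?thesis
      using step[OF u(1) t(1) u(3) t(2) u(5)] t(3) 2 ip_sym[of t v] by (simp add: ip_simps)
  next
    case 3 then show ?thesis using step u by metis
  qed (use u in simp)
  show ?thesis
  proof (cases "ip u\<^sub>0 a = 0")
    case True
    have "Q u\<^sub>0 a" by (rule step'[OF start(1,2) ab(1) start(3) True start(4)])
    then show ?thesis using step'[OF ab(1) start(1) ab(2) _ ab(3)] sym True ip_sym by metis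
  next
    case False
    then have "a = u\<^sub>0 \<or> a = - u\<^sub>0" using ip_E_cases[OF start(1) ab(1)] by metis
    then have 0: "ip u\<^sub>0 b = 0" using ab(3) by (auto simp: ip_simps)
    have "Q u\<^sub>0 b" by (rule step'[OF start(1,2) ab(2) start(3) 0 start(4)])
    then have "Q b a" using step'[OF ab(2) start(1) ab(1)] sym 0 ab(3) ip_sym by metis
    then show ?thesis by (rule sym)
  qed
qed

section \<open>The systems of even offset\<close>

text \<open>
  If \<open>ip \<cdot> w\<close> represents \<open>p\<close>, this is the coefficient of \<open>\<delta>\<close> in \<open>\<gamma>\<close>, measured from its prescribed
  value \<open>p\<close>. It is linear in \<open>\<gamma>\<close>, so \<open>\<Psi>\<^sub>p\<close> becomes the set of roots where it is an even integer.
\<close>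

definition offset :: "'v \<Rightarrow> 'v \<Rightarrow> real" where
  "offset w \<gamma> = d \<gamma> - ip \<gamma> w"

definition even_part :: "'v \<Rightarrow> 'v set" where
  "even_part w = {\<gamma> \<in> \<Phi>. offset w \<gamma> / 2 \<in> \<int>}"

text \<open>
  This is the parity condition on \<open>p\<close>, since
  $p_{\epsilon_s+\epsilon_t} - p_{\epsilon_s-\epsilon_t} = 2(\epsilon_t, w)$ has to be odd.
\<close>

definition half_odd :: "'v \<Rightarrow> bool" where
  "half_odd w \<longleftrightarrow> (\<forall>i\<in>{1..n}. ip (eps i) w - 1 / 2 \<in> \<int>)"

lemma offset_linear: "linear (offset w)"
  by (rule linearI) (simp_all add: offset_def d_simps ip_simps algebra_simps)

lemma offset_add: "offset w (x + y) = offset w x + offset w y"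
  and offset_neg: "offset w (- x) = - offset w x"
  by (simp_all add: linear_add linear_neg offset_linear)

lemma offset_short: "u \<in> E \<Longrightarrow> v \<in> E \<Longrightarrow> offset w (u + v + t *\<^sub>R \<delta>) = t - ip u w - ip v w"
  by (simp add: offset_def d_simps d_E ip_simps)

lemma offset_long: "u \<in> E \<Longrightarrow> offset w (2 *\<^sub>R u + t *\<^sub>R \<delta>) = t - 2 * ip u w"
  by (simp add: offset_def d_simps d_E ip_simps)

lemma half_odd_E:
  assumes "half_odd w" "u \<in> E"
  obtains m :: int where "ip u w = of_int m + 1 / 2"
proof -
  from assms(2) obtain i where i: "i \<in> {1..n}" "u = eps i \<or> u = - eps i" unfolding signed_units_def by auto
  then obtain m where m: "ip (eps i) w - 1 / 2 = of_int m"
    using assms(1) Ints_cases unfolding half_odd_def by metis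
  show thesis
    using i(2)
  proof
    assume "u = eps i" then show thesis using that[of m] m by simp
  next
    assume "u = - eps i" then show thesis using that[of "- m - 1"] m by (simp add: ip_simps)
  qed
qed

lemma half_odd_ip_short:
  assumes "half_odd w" "u \<in> E" "v \<in> E"
  obtains m :: int where "ip u w + ip v w = of_int m"
proof -
  obtain i j :: int where "ip u w = of_int i + 1 / 2" "ip v w = of_int j + 1 / 2"
    using half_odd_E assms by metis
  then show thesis using that[of "i + j + 1"] by simp
qed

lemma even_iff_half_Ints: "(of_int m / 2 :: real) \<in> \<int> \<longleftrightarrow> even m"
proof
  assume "(of_int m / 2 :: real) \<in> \<int>"
  then obtain k :: int where "(of_int m / 2 :: real) = of_int k" by (auto elim: Ints_cases)
  then have "real_of_int m = of_int (2 * k)" by simp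
  then show "even m" unfolding of_int_eq_iff by simp
qed (auto elim: evenE)

text \<open>
  On long roots of the affine system \<open>t\<close> is even, so their offset is odd and the even part
  consists of short roots only.
\<close>

lemma offset_long_odd:
  assumes "half_odd w" "u \<in> E"
  shows "offset w (2 *\<^sub>R u + of_int t *\<^sub>R \<delta>) / 2 \<in> \<int> \<longleftrightarrow> odd t"
proof -
  obtain m :: int where "ip u w = of_int m + 1 / 2" using half_odd_E assms by metis
  then have "offset w (2 *\<^sub>R u + of_int t *\<^sub>R \<delta>) = of_int (t - 2 * m - 1)"
    by (simp add: offset_long assms)
  then show ?thesis using even_iff_half_Ints[of "t - 2 * m - 1"] by simp
qed

lemma even_part_cases:
  assumes "half_odd w" "\<gamma> \<in> even_part w"
  obtains u v t where "u \<in> E" "v \<in> E" "ip u v = 0" "\<gamma> = u + v + of_int t *\<^sub>R \<delta>"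
    "offset w \<gamma> / 2 \<in> \<int>"
proof -
  from assms(2) have g: "\<gamma> \<in> \<Phi>" "offset w \<gamma> / 2 \<in> \<int>" unfolding even_part_def by auto
  from g(1) show thesis
  proof (cases rule: Phi_cases)
    case short then show thesis using that g(2) by metis
  next
    case long then show thesis using offset_long_odd[OF assms(1)] g(2) by metis
  qed
qed

lemma even_part_memI:
  "u \<in> E \<Longrightarrow> v \<in> E \<Longrightarrow> ip u v = 0 \<Longrightarrow> offset w (u + v + of_int t *\<^sub>R \<delta>) / 2 \<in> \<int> \<Longrightarrow>
    u + v + of_int t *\<^sub>R \<delta> \<in> even_part w"
  unfolding even_part_def using short_in_Phi by blast

lemma even_part_lift:
  assumes "half_odd w" "u \<in> E" "v \<in> E" "ip u v = 0"
  obtains t where "u + v + of_int t *\<^sub>R \<delta> \<in> even_part w"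
    "\<not> offset w (u + v + of_int (t + 1) *\<^sub>R \<delta>) / 2 \<in> \<int>"
proof -
  obtain m :: int where m: "ip u w + ip v w = of_int m"
    using half_odd_ip_short assms by metis
  have "offset w (u + v + of_int t *\<^sub>R \<delta>) = of_int (t - m)" for t
    using m by (simp add: offset_short assms(2,3))
  then have "offset w (u + v + of_int t *\<^sub>R \<delta>) / 2 \<in> \<int> \<longleftrightarrow> even (t - m)" for t
    unfolding even_iff_half_Ints[symmetric] by simp
  note h = this
  show thesis
    by (rule that[of m], rule even_part_memI[OF assms(2-4)]) (unfold h, simp_all)
qed

lemma offset_odd_diff:
  assumes "half_odd w" "a \<in> E" "b \<in> E" "a' \<in> E" "b' \<in> E"
    "\<not> offset w (a + b + of_int t *\<^sub>R \<delta>) / 2 \<in> \<int>" "\<not> offset w (a' + b' + of_int t' *\<^sub>R \<delta>) / 2 \<in> \<int>"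
  shows "(offset w (a + b + of_int t *\<^sub>R \<delta>) - offset w (a' + b' + of_int t' *\<^sub>R \<delta>)) / 2 \<in> \<int>"
proof -
  obtain m m' :: int where "ip a w + ip b w = of_int m" "ip a' w + ip b' w = of_int m'"
    using half_odd_ip_short assms by metis
  then have h: "offset w (a + b + of_int t *\<^sub>R \<delta>) = of_int (t - m)"
    "offset w (a' + b' + of_int t' *\<^sub>R \<delta>) = of_int (t' - m')"
    using assms by (simp_all add: offset_short)
  show ?thesis
    using assms(6,7) unfolding h of_int_diff[symmetric] even_iff_half_Ints by simp
qed

lemma even_part_closed:
  assumes "half_odd w" shows "closed_subroot_system ip \<Phi> (even_part w)"
proof -
  have 1: "eps 1 \<in> E" using E_eps n by simp
  obtain z where z: "z \<in> E" "ip (eps 1) z = 0" using perp_third[OF 1 1] by metis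
  obtain t where "eps 1 + z + of_int t *\<^sub>R \<delta> \<in> even_part w" using even_part_lift[OF assms 1 z] by metis
  then show ?thesis
    unfolding even_part_def by (intro mod2_kernel_closed_subroot_system offset_linear) auto
qed

lemma long_not_even_part:
  assumes "half_odd w" "u \<in> E"
  shows "2 *\<^sub>R u + of_int t *\<^sub>R \<delta> \<notin> even_part w"
proof
  assume "2 *\<^sub>R u + of_int t *\<^sub>R \<delta> \<in> even_part w"
  then have "odd t" "2 *\<^sub>R u + of_int t *\<^sub>R \<delta> \<in> \<Phi>"
    using offset_long_odd[OF assms] unfolding even_part_def by auto
  then have "2 *\<^sub>R u \<in> D" using lift_in_Phi_iff[OF long_in_C[OF assms(2)]] by blast
  then show False using D_not_L L_iff assms(2) by blast
qed

lemma even_part_proper: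
  assumes "half_odd w" shows "even_part w \<noteq> \<Phi>"
proof -
  have 1: "eps 1 \<in> E" using E_eps n by simp
  show ?thesis using long_not_even_part[OF assms 1, of 0] long_in_Phi[OF 1, of 0] by auto
qed

text \<open>
  A root with odd offset has its offset changed by an even amount when a root of the even part is
  added. A closed system that contains the even part and one further root therefore contains all
  roots with odd offset that can be reached by such additions, and by connectedness of the
  orthogonal pairs these are all the short ones. Long roots are sums of two short ones.
\<close>

lemma even_part_no_intermediate:
  assumes w: "half_odd w" and cl: "closed_subroot_system ip \<Phi> \<Delta>"
    and sub: "even_part w \<subseteq> \<Delta>" and \<gamma>: "\<gamma> \<in> \<Delta>" "\<gamma> \<notin> even_part w"
  shows "\<Delta> = \<Phi>"
proof -
  have sum: "\<alpha> + \<beta> \<in> \<Delta>" if "\<alpha> \<in> \<Delta>" "\<beta> \<in> \<Delta>" "\<alpha> + \<beta> \<in> \<Phi>" for \<alpha> \<beta>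
    using cl that unfolding closed_subroot_system_def closed_in_roots_def by blast
  have \<Delta>\<Phi>: "\<Delta> \<subseteq> \<Phi>" using cl unfolding closed_subroot_system_def subroot_system_def by blast
  define Q where "Q u v \<longleftrightarrow> (\<forall>t. u + v + of_int t *\<^sub>R \<delta> \<in> \<Delta>)" for u v
  have spread: "Q u z"
    if E: "u \<in> E" "v \<in> E" "z \<in> E" and perp: "ip u v = 0" "ip u z = 0" "ip v z = 0"
      and t: "u + v + of_int t *\<^sub>R \<delta> \<in> \<Delta>" "\<not> offset w (u + v + of_int t *\<^sub>R \<delta>) / 2 \<in> \<int>"
    for u v z t
    unfolding Q_def
  proof
    fix s
    show "u + z + of_int s *\<^sub>R \<delta> \<in> \<Delta>"
    proof (cases "offset w (u + z + of_int s *\<^sub>R \<delta>) / 2 \<in> \<int>")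
      case True
      then show ?thesis using even_part_memI E perp sub by blast
    next
      case False
      \<comment> \<open>This is a difference of two odd offsets, so it can be bridged by a root of the even part.\<close>
      have "offset w (z + - v + of_int (s - t) *\<^sub>R \<delta>) =
          offset w (u + z + of_int s *\<^sub>R \<delta>) - offset w (u + v + of_int t *\<^sub>R \<delta>)"
        unfolding offset_short[OF E(3) E_neg[OF E(2)]] offset_short[OF E(1,2)] offset_short[OF E(1,3)]
        by (simp add: ip_simps)
      then have "offset w (z + - v + of_int (s - t) *\<^sub>R \<delta>) / 2 \<in> \<int>"
        using offset_odd_diff[OF w E(1,3,1,2) False t(2)] by simp
      moreover have "ip z (- v) = 0" using perp ip_sym[of z v] by (simp add: ip_simps)
      ultimately have k: "z + - v + of_int (s - t) *\<^sub>R \<delta> \<in> \<Delta>"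
        using even_part_memI[OF E(3) E_neg[OF E(2)]] sub by blast
      have eq: "(u + v + of_int t *\<^sub>R \<delta>) + (z + - v + of_int (s - t) *\<^sub>R \<delta>) = u + z + of_int s *\<^sub>R \<delta>"
        by (simp add: algebra_simps)
      show ?thesis
        using sum[OF t(1) k] short_in_Phi[OF E(1,3) perp(2)] unfolding eq by blast
    qed
  qed
  have "\<exists>u\<in>E. \<exists>v\<in>E. \<exists>t. ip u v = 0 \<and> u + v + of_int t *\<^sub>R \<delta> \<in> \<Delta> \<and>
      \<not> offset w (u + v + of_int t *\<^sub>R \<delta>) / 2 \<in> \<int>"
  proof -
    have "\<gamma> \<in> \<Phi>" using \<Delta>\<Phi> \<gamma> by blast
    then show ?thesis
    proof (cases rule: Phi_cases)
      case (short u v t)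
      then show ?thesis using \<gamma> unfolding even_part_def
        using \<open>\<gamma> \<in> \<Phi>\<close> by blast
    next
      case (long u t)
      obtain v where v: "v \<in> E" "ip u v = 0" using perp_third[OF long(1,1)] by metis
      have nuv: "ip (- u) v = 0" using v by (simp add: ip_simps)
      obtain s where s: "- u + v + of_int s *\<^sub>R \<delta> \<in> even_part w"
        using even_part_lift[OF w E_neg[OF long(1)] v(1) nuv] by metis
      \<comment> \<open>A long root turns a short root of even offset into one of odd offset.\<close>
      have eq: "\<gamma> + (- u + v + of_int s *\<^sub>R \<delta>) = u + v + of_int (t + s) *\<^sub>R \<delta>"
        unfolding long(3) by (simp add: algebra_simps scaleR_2)
      have s\<Delta>: "- u + v + of_int s *\<^sub>R \<delta> \<in> \<Delta>" using s sub by blast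
      have 1: "u + v + of_int (t + s) *\<^sub>R \<delta> \<in> \<Delta>"
        using sum[OF \<gamma>(1) s\<Delta>] short_in_Phi[OF long(1) v, of "t + s"] unfolding eq by blast
      have "\<not> offset w \<gamma> / 2 \<in> \<int>" using offset_long_odd[OF w long(1)] long by simp
      then have "\<not> offset w (u + v + of_int (t + s) *\<^sub>R \<delta>) / 2 \<in> \<int>"
        using s Ints_diff[of "offset w \<gamma> / 2 + offset w (- u + v + of_int s *\<^sub>R \<delta>) / 2"
            "offset w (- u + v + of_int s *\<^sub>R \<delta>) / 2"]
        unfolding eq[symmetric] offset_add[of w \<gamma>] add_divide_distrib even_part_def by simp
      then show ?thesis using long(1) v 1 by blast
    qed
  qed
  then obtain u v t where uv: "u \<in> E" "v \<in> E" "ip u v = 0" "u + v + of_int t *\<^sub>R \<delta> \<in> \<Delta>"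
      "\<not> offset w (u + v + of_int t *\<^sub>R \<delta>) / 2 \<in> \<int>" by blast
  \<comment> \<open>One short root of odd offset over \<open>u + v\<close> already yields every root over \<open>u + z\<close>.\<close>
  obtain z where z: "z \<in> E" "ip u z = 0" "ip v z = 0" using perp_third[OF uv(1,2)] by metis
  have start: "Q u z" by (rule spread[OF uv(1,2) z(1) uv(3) z(2,3) uv(4,5)])
  have Q: "Q a b" if "a \<in> E" "b \<in> E" "ip a b = 0" for a b
  proof (rule perp_pairs_connected[where Q = Q, OF _ _ uv(1) z(1,2) start that])
    show "Q v u" if "Q u v" for u v using that by (simp add: Q_def add.commute)
    show "Q u z" if E: "u \<in> E" "v \<in> E" "z \<in> E" "ip u v = 0" "ip u z = 0" "ip v z = 0" and q: "Q u v"
      for u v z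
    proof -
      obtain t where "\<not> offset w (u + v + of_int (t + 1) *\<^sub>R \<delta>) / 2 \<in> \<int>"
        using even_part_lift[OF w E(1,2,4)] by metis
      then show ?thesis using spread[OF E] q unfolding Q_def by blast
    qed
  qed
  have "\<Phi> \<subseteq> \<Delta>"
  proof
    fix \<eta> assume "\<eta> \<in> \<Phi>"
    then show "\<eta> \<in> \<Delta>"
    proof (cases rule: Phi_cases)
      case (short u v t) then show ?thesis using Q unfolding Q_def by blast
    next
      case (long u t)
      obtain v where v: "v \<in> E" "ip u v = 0" using perp_third[OF long(1,1)] by metis
      have "u + v + of_int t *\<^sub>R \<delta> \<in> \<Delta>" using Q[OF long(1) v] Q_def by blast
      moreover have "u + - v + of_int 0 *\<^sub>R \<delta> \<in> \<Delta>"
        using Q[OF long(1) E_neg[OF v(1)]] v(2) unfolding Q_def by (simp only: ip_simps)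
      moreover have "\<eta> = (u + v + of_int t *\<^sub>R \<delta>) + (u + - v + of_int 0 *\<^sub>R \<delta>)"
        unfolding long by (simp add: scaleR_2)
      ultimately show ?thesis using sum \<open>\<eta> \<in> \<Phi>\<close> by metis
    qed
  qed
  then show ?thesis using \<Delta>\<Phi> by blast
qed

lemma even_part_maximal:
  assumes "half_odd w" shows "maximal_closed_subroot_system ip \<Phi> (even_part w)"
  unfolding maximal_closed_subroot_system_def
  using even_part_closed[OF assms] even_part_proper[OF assms] even_part_no_intermediate[OF assms] by blast

lemma gradient_even_part:
  assumes "half_odd w" shows "gradient eps \<delta> n (even_part w) = D"
proof (intro set_eqI iffI)
  fix \<alpha> assume "\<alpha> \<in> D"
  then obtain u v where uv: "u \<in> E" "v \<in> E" "ip u v = 0" "\<alpha> = u + v" unfolding D_iff by blast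
  then obtain t where "u + v + of_int t *\<^sub>R \<delta> \<in> even_part w" using even_part_lift[OF assms] by metis
  then show "\<alpha> \<in> gradient eps \<delta> n (even_part w)"
    unfolding gradient_def using uv short_in_C by blast
next
  fix \<alpha> assume "\<alpha> \<in> gradient eps \<delta> n (even_part w)"
  then obtain r where r: "\<alpha> \<in> C" "\<alpha> + of_int r *\<^sub>R \<delta> \<in> even_part w" unfolding gradient_def by blast
  from r(1) show "\<alpha> \<in> D"
  proof (cases rule: C_cases)
    case short then show ?thesis unfolding D_iff by blast
  next
    case long then show ?thesis using r(2) long_not_even_part[OF assms] by blast
  qed
qed

lemma D_semi_closed: "semi_closed ip eps n D" and D_proper: "D \<noteq> C"
proof -
  have 1: "eps 1 \<in> E" using E_eps n by simp
  obtain z where z: "z \<in> E" "ip (eps 1) z = 0" using perp_third[OF 1 1] by metis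
  have a: "eps 1 + z \<in> D" "eps 1 + - z \<in> D"
    using D_I[OF 1 z] D_I[OF 1 E_neg[OF z(1)]] z(2) by (auto simp: ip_simps)
  have l: "2 *\<^sub>R eps 1 \<in> L" "2 *\<^sub>R eps 1 \<in> C" using 1 L_iff long_in_C by blast+
  then have nd: "2 *\<^sub>R eps 1 \<notin> D" using D_not_L by blast
  then show "D \<noteq> C" using l by blast
  have eq: "(eps 1 + z) + (eps 1 + - z) = 2 *\<^sub>R eps 1" by (simp add: scaleR_2)
  have "subroot_system ip C D"
    unfolding subroot_system_def using a C_iff reflect_short by blast
  moreover have "\<not> closed_in_roots C D"
    unfolding closed_in_roots_def using a l nd eq by metis
  ultimately show "semi_closed ip eps n D"
    unfolding semi_closed_def using C_iff by blast
qed

section \<open>Maximal systems with semi-closed gradient\<close>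

lemma gradient_iff: "\<alpha> \<in> gradient eps \<delta> n \<Psi> \<longleftrightarrow> \<alpha> \<in> C \<and> (\<exists>r::int. \<alpha> + of_int r *\<^sub>R \<delta> \<in> \<Psi>)"
  unfolding gradient_def by blast

lemma subroot_neg:
  assumes "subroot_system ip C G" "\<alpha> \<in> G" shows "- \<alpha> \<in> G"
  using assms reflect_self[OF norm_C] unfolding subroot_system_def by (metis subsetD)

lemma reflect_short_eq:
  "u \<in> E \<Longrightarrow> v \<in> E \<Longrightarrow> ip u v = 0 \<Longrightarrow>
    reflect ip (u + v) x = x - (ip x u + ip x v) *\<^sub>R (u + v)"
  using pairing_short[OF D_I] by (simp add: reflect_def ip_simps)

text \<open>
  A short root has pairing at most 1 with a signed unit vector. Hence two short roots with sum
  \<open>2z\<close> both attain 1, which determines their shape \<open>z + y\<close>, \<open>z - y\<close>.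
\<close>

lemma short_root_split:
  assumes "\<alpha> \<in> D" "z \<in> E"
  shows "ip \<alpha> z \<le> 1" and "ip \<alpha> z = 1 \<Longrightarrow> \<exists>y\<in>E. ip z y = 0 \<and> \<alpha> = z + y"
proof -
  obtain u v where uv: "u \<in> E" "v \<in> E" "ip u v = 0" "\<alpha> = u + v"
    using assms(1) unfolding D_iff by blast
  have vu: "ip v u = 0" using uv(3) ip_sym by metis
  have "ip \<alpha> z \<le> 1 \<and> (ip \<alpha> z = 1 \<longrightarrow> (\<exists>y\<in>E. ip z y = 0 \<and> \<alpha> = z + y))"
    using uv(1) assms(2)
  proof (cases rule: ip_E_cases)
    case 1
    then show ?thesis using uv vu by (auto simp: ip_simps)
  next
    case 2
    then show ?thesis using uv vu by (auto simp: ip_simps)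
  next
    case 3
    have zu: "ip z u = 0" using 3 ip_sym by metis
    show ?thesis
      using uv(2) assms(2)
    proof (cases rule: ip_E_cases)
      case 1
      then show ?thesis using uv zu 3 by (auto simp: ip_simps add.commute)
    next
      case 2
      then show ?thesis using uv 3 by (auto simp: ip_simps)
    qed (use uv 3 in \<open>auto simp: ip_simps\<close>)
  qed
  then show "ip \<alpha> z \<le> 1" "ip \<alpha> z = 1 \<Longrightarrow> \<exists>y\<in>E. ip z y = 0 \<and> \<alpha> = z + y" by blast+
qed

lemma semi_closed_witness:
  assumes "semi_closed ip eps n G"
  obtains x y where "x \<in> E" "y \<in> E" "ip x y = 0" "x + y \<in> G" "x - y \<in> G" "2 *\<^sub>R x \<notin> G"
proof -
  obtain \<alpha> \<beta> where ab: "\<alpha> \<in> G" "\<beta> \<in> G" "\<alpha> + \<beta> \<in> C" "\<alpha> + \<beta> \<notin> G"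
    using assms unfolding semi_closed_def closed_in_roots_def by blast
  then have "\<alpha> \<in> D" "\<beta> \<in> D" "\<alpha> + \<beta> \<in> L"
    using assms unfolding semi_closed_def by blast+
  then obtain z where z: "z \<in> E" "\<alpha> + \<beta> = 2 *\<^sub>R z" unfolding L_iff by blast
  have "ip \<alpha> z + ip \<beta> z = ip (\<alpha> + \<beta>) z" by (simp add: ip_simps)
  also have "\<dots> = 2" unfolding z(2) by (simp add: ip_simps ip_E_self z)
  finally have "ip \<alpha> z = 1"
    using short_root_split(1)[OF \<open>\<alpha> \<in> D\<close> z(1)] short_root_split(1)[OF \<open>\<beta> \<in> D\<close> z(1)] by linarith
  then obtain y where y: "y \<in> E" "ip z y = 0" "\<alpha> = z + y"
    using short_root_split(2)[OF \<open>\<alpha> \<in> D\<close> z(1)] by blast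
  have "\<beta> = (\<alpha> + \<beta>) - \<alpha>" by simp
  also have "\<dots> = z - y" unfolding z(2) unfolding y(3) by (simp add: scaleR_2)
  finally have \<beta>: "\<beta> = z - y" .
  show thesis
    by (rule that[OF z(1) y(1,2)]) (use ab y(3) \<beta> z(2) in auto)
qed

lemma ip_eps_sum:
  assumes "i \<in> {1..n}" shows "ip (eps i) (\<Sum>k\<in>{1..n}. a k *\<^sub>R eps k) = a i"
proof -
  have "linear (ip (eps i))" using ip_bilinear unfolding bilinear_def by blast
  then have "ip (eps i) (\<Sum>k\<in>{1..n}. a k *\<^sub>R eps k) = (\<Sum>k\<in>{1..n}. a k * ip (eps i) (eps k))"
    by (simp add: linear_sum linear_scale)
  also have "\<dots> = (\<Sum>k\<in>{1..n}. if k = i then a k else 0)"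
    using assms by (intro sum.cong) (auto simp: orthonormal)
  finally show ?thesis using assms by simp
qed

text \<open>
  The signed unit vectors linked to \<open>x\<close> through roots of the gradient form a block \<open>B\<close>, and every
  root of \<open>\<Psi>\<close> is supported inside \<open>B\<close> or outside it. The roots with this property are the mod 2
  kernel of \<open>ip \<cdot> b\<close>, where \<open>b\<close> sums the \<open>eps k\<close> in \<open>B\<close>. They form a closed subroot system, and it is
  strictly larger than \<open>\<Psi>\<close> because it contains \<open>2x\<close>. Maximality makes it the whole of the affine
  system, so the block is everything.
\<close>

lemma maximal_imp_units_linked:
  assumes max: "maximal_closed_subroot_system ip \<Phi> \<Psi>"
    and G: "subroot_system ip C (gradient eps \<delta> n \<Psi>)"
    and x: "x \<in> E" "2 *\<^sub>R x \<notin> gradient eps \<delta> n \<Psi>"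
    and u: "u \<in> E" "ip u x = 0"
  shows "x + u \<in> gradient eps \<delta> n \<Psi> \<or> x - u \<in> gradient eps \<delta> n \<Psi>"
    (is "x + u \<in> ?G \<or> _")
proof -
  have Grefl: "reflect ip \<alpha> \<beta> \<in> ?G" if "\<alpha> \<in> ?G" "\<beta> \<in> ?G" for \<alpha> \<beta>
    using G that unfolding subroot_system_def by blast
  note Gneg = subroot_neg[OF G]
  have xx: "ip x x = 1" using x ip_E_self by blast
  define B where "B u \<longleftrightarrow> u = x \<or> u = - x \<or> x + u \<in> ?G \<or> x - u \<in> ?G" for u
  have Bneg: "B (- u) \<longleftrightarrow> B u" for u unfolding B_def by (auto simp: minus_equation_iff)
  have Bstep: "B v" if uv: "u \<in> E" "v \<in> E" "ip u v = 0" "u + v \<in> ?G" "B u" for u v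
    using uv(1) x(1)
  proof (cases rule: ip_E_cases)
    case 1 then show ?thesis using uv unfolding B_def by simp
  next
    case 2
    then have "x - v = - (u + v)" by simp
    then show ?thesis using Gneg[OF uv(4)] unfolding B_def by metis
  next
    case ux: 3
    show ?thesis
      using uv(2) x(1)
    proof (cases rule: ip_E_cases)
      case vx: 3
      have 0: "ip x u = 0" "ip x v = 0" using ux vx ip_sym by metis+
      have "u \<noteq> x" "u \<noteq> - x" using ux xx by (auto simp: ip_simps)
      then consider "x + u \<in> ?G" | "x - u \<in> ?G" using uv(5) unfolding B_def by blast
      then show ?thesis
      proof cases
        case 1
        have "reflect ip (u + v) (x + u) = x - v"
          using reflect_short_eq[OF uv(1-3), of "x + u"] 0 uv by (simp add: ip_simps ip_E_self)
        then show ?thesis using Grefl[OF uv(4) 1] unfolding B_def by simp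
      next
        case 2
        have "reflect ip (u + v) (x - u) = x + v"
          using reflect_short_eq[OF uv(1-3), of "x - u"] 0 uv by (simp add: ip_simps ip_E_self)
        then show ?thesis using Grefl[OF uv(4) 2] unfolding B_def by simp
      qed
    qed (auto simp: B_def)
  qed
  define b where "b = (\<Sum>k\<in>{1..n}. (if B (eps k) then 1 else 0) *\<^sub>R eps k)"
  have ipb: "(B u \<and> (ip u b = 1 \<or> ip u b = - 1)) \<or> (\<not> B u \<and> ip u b = 0)" if "u \<in> E" for u
  proof -
    obtain i where i: "i \<in> {1..n}" "u = eps i \<or> u = - eps i" using \<open>u \<in> E\<close> unfolding signed_units_def by auto
    have "ip (eps i) b = (if B (eps i) then 1 else 0)" unfolding b_def by (rule ip_eps_sum[OF i(1)])
    then show ?thesis using i(2) Bneg[of "eps i"] by (auto simp: ip_simps split: if_splits)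
  qed
  define \<Delta> where "\<Delta> = {\<gamma> \<in> \<Phi>. ip \<gamma> b / 2 \<in> \<int>}"
  have lin: "linear (\<lambda>\<gamma>. ip \<gamma> b)" using ip_bilinear unfolding bilinear_def by blast
  have x2: "2 *\<^sub>R x + of_int 0 *\<^sub>R \<delta> \<in> \<Delta>"
    unfolding \<Delta>_def using long_in_Phi[OF x(1), of 0] ipb[OF x(1)] by (auto simp: ip_simps)
  then have cl: "closed_subroot_system ip \<Phi> \<Delta>"
    unfolding \<Delta>_def using mod2_kernel_closed_subroot_system[OF lin] by blast
  have \<Psi>\<Phi>: "\<Psi> \<subseteq> \<Phi>"
    using max unfolding maximal_closed_subroot_system_def closed_subroot_system_def
      subroot_system_def by blast
  have "\<Psi> \<subseteq> \<Delta>"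
  proof
    fix \<gamma> assume g: "\<gamma> \<in> \<Psi>"
    then have "\<gamma> \<in> \<Phi>" using \<Psi>\<Phi> by blast
    then show "\<gamma> \<in> \<Delta>"
    proof (cases rule: Phi_cases)
      case (short u v t)
      then have uvG: "u + v \<in> ?G" unfolding gradient_iff using g short_in_C by blast
      have vu: "ip v u = 0" using short(3) ip_sym by metis
      have "B u \<longleftrightarrow> B v"
        using Bstep[OF short(1-3) uvG] Bstep[OF short(2,1) vu] uvG by (metis add.commute)
      then show ?thesis
        unfolding \<Delta>_def using \<open>\<gamma> \<in> \<Phi>\<close> ipb[OF short(1)] ipb[OF short(2)] short(4)
        by (auto simp: ip_simps)
    next
      case (long u t)
      then show ?thesis
        unfolding \<Delta>_def using \<open>\<gamma> \<in> \<Phi>\<close> ipb[OF long(1)] by (auto simp: ip_simps)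
    qed
  qed
  moreover have "\<Delta> \<noteq> \<Psi>"
  proof
    assume "\<Delta> = \<Psi>"
    then have "2 *\<^sub>R x \<in> ?G" unfolding gradient_iff using x2 long_in_C[OF x(1)] by blast
    then show False using x by blast
  qed
  moreover have "\<Delta> \<subseteq> \<Phi>" unfolding \<Delta>_def by blast
  ultimately have full: "\<Delta> = \<Phi>"
    using max cl unfolding maximal_closed_subroot_system_def by blast
  have xu: "ip x u = 0" using u ip_sym by metis
  have "x + u + of_int 0 *\<^sub>R \<delta> \<in> \<Delta>"
    unfolding full by (rule short_in_Phi[OF x(1) u(1) xu])
  then have i: "(ip x b + ip u b) / 2 \<in> \<int>" unfolding \<Delta>_def by (simp add: ip_simps)
  have "B x" unfolding B_def by simp
  then have bx: "ip x b = of_int 1 \<or> ip x b = of_int (-1)" using ipb[OF x(1)] by simp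
  have "B u"
  proof (rule ccontr)
    assume "\<not> B u"
    then have "ip u b = 0" using ipb[OF u(1)] by simp
    then show False using i bx even_iff_half_Ints[of 1] even_iff_half_Ints[of "-1"] by auto
  qed
  moreover have "u \<noteq> x" "u \<noteq> - x" using u(2) xx by (auto simp: ip_simps)
  ultimately show ?thesis unfolding B_def by blast
qed

text \<open>
  Semi-closedness provides \<open>x + y\<close> and \<open>x - y\<close> in the gradient but not \<open>2x\<close>. The product of the two
  reflections negates \<open>x\<close> and fixes every \<open>u\<close> orthogonal to \<open>x\<close> and \<open>y\<close>. Hence one of \<open>x + u\<close>, \<open>x - u\<close>
  in the gradient brings in the other, and reflecting produces all short roots. These conjugate
  any long root to \<open>2x\<close>, so none occurs.
\<close>

lemma gradient_is_D:
  assumes max: "maximal_closed_subroot_system ip \<Phi> \<Psi>"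
    and sc: "semi_closed ip eps n (gradient eps \<delta> n \<Psi>)"
  shows "gradient eps \<delta> n \<Psi> = D" (is "?G = D")
proof -
  have G: "subroot_system ip C ?G" using sc unfolding semi_closed_def by blast
  have Grefl: "reflect ip \<alpha> \<beta> \<in> ?G" if "\<alpha> \<in> ?G" "\<beta> \<in> ?G" for \<alpha> \<beta>
    using G that unfolding subroot_system_def by blast
  note Gneg = subroot_neg[OF G]
  obtain x y where xy: "x \<in> E" "y \<in> E" "ip x y = 0" "x + y \<in> ?G" "x - y \<in> ?G" "2 *\<^sub>R x \<notin> ?G"
    using semi_closed_witness[OF sc] by metis
  have yx: "ip y x = 0" and nxy: "ip x (- y) = 0"
    using xy(3) ip_sym by (simp_all add: ip_simps)
  have xx: "ip x x = 1" "ip y y = 1" using xy ip_E_self by blast+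
  have xu: "x + u \<in> ?G \<and> x - u \<in> ?G" if u: "u \<in> E" "ip u x = 0" for u
    using u(1) xy(2)
  proof (cases rule: ip_E_cases)
    case uy: 3
    have 0: "ip x u = 0" "ip y u = 0" using u uy ip_sym by metis+
    have flip: "- x + s *\<^sub>R u \<in> ?G" if "x + s *\<^sub>R u \<in> ?G" for s
    proof -
      have 1: "reflect ip (x + - y) (x + s *\<^sub>R u) = y + s *\<^sub>R u"
        using u uy xy yx xx reflect_short_eq[OF xy(1) E_neg[OF xy(2)] nxy, of "x + s *\<^sub>R u"]
        by (simp add: ip_simps)
      have 2: "reflect ip (x + y) (y + s *\<^sub>R u) = - x + s *\<^sub>R u"
        using u uy xy yx xx reflect_short_eq[OF xy(1-3), of "y + s *\<^sub>R u"]
        by (simp add: ip_simps)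
      have "y + s *\<^sub>R u \<in> ?G" using Grefl[of "x - y" "x + s *\<^sub>R u"] that xy 1 by simp
      then show ?thesis using Grefl[of "x + y" "y + s *\<^sub>R u"] xy 2 by simp
    qed
    have "x + u \<in> ?G \<or> x - u \<in> ?G" by (rule maximal_imp_units_linked[OF max G xy(1,6) u])
    moreover have "x - u \<in> ?G" if "x + u \<in> ?G" using flip[of 1] Gneg[of "- x + u"] that by simp
    moreover have "x + u \<in> ?G" if "x - u \<in> ?G"
    proof -
      have "- (- x - u) = x + u" by simp
      then show ?thesis using flip[of "- 1"] Gneg[of "- x - u"] that by (metis diff_conv_add_uminus scaleR_minus1_left)
    qed
    ultimately show ?thesis by blast
  qed (use xy in auto)
  have D_sub: "u + v \<in> ?G" if uv: "u \<in> E" "v \<in> E" "ip u v = 0" for u v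
    using uv(1) xy(1)
  proof (cases rule: ip_E_cases)
    case 1 then show ?thesis using xu[OF uv(2)] uv(3) ip_sym by metis
  next
    case 2
    then have u: "u = - x" by simp
    then have "ip v x = 0" using uv(3) ip_sym[of v x] by (simp add: ip_simps)
    then show ?thesis using xu[OF uv(2)] Gneg[of "x - v"] u by simp
  next
    case ux: 3
    show ?thesis
      using uv(2) xy(1)
    proof (cases rule: ip_E_cases)
      case 1 then show ?thesis using xu[OF uv(1)] ux by (simp add: add.commute)
    next
      case 2
      then have "v = - x" by simp
      then show ?thesis using xu[OF uv(1) ux] Gneg[of "x - u"] by simp
    next
      case vx: 3
      have 0: "ip x (- u) = 0" "ip v u = 0" "ip x u = 0"
        using ux uv(3) ip_sym by (simp_all add: ip_simps)
      have "reflect ip (x + - u) (x + v) = u + v"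
        using reflect_short_eq[OF xy(1) E_neg[OF uv(1)] 0(1), of "x + v"] xx vx 0
        by (simp add: ip_simps)
      then show ?thesis using Grefl[of "x - u" "x + v"] xu[OF uv(1) ux] xu[OF uv(2) vx] by simp
    qed
  qed
  have no_long: "2 *\<^sub>R u \<notin> ?G" if u: "u \<in> E" for u
  proof
    assume g: "2 *\<^sub>R u \<in> ?G"
    show False
      using u xy(1)
    proof (cases rule: ip_E_cases)
      case 1 then show False using g xy by simp
    next
      case 2 then show False using Gneg[OF g] xy by simp
    next
      case 3
      have 0: "ip x (- u) = 0" using 3 ip_sym[of u x] by (simp add: ip_simps)
      have "reflect ip (x + - u) (2 *\<^sub>R u) = 2 *\<^sub>R x"
        using reflect_short_eq[OF xy(1) E_neg[OF u] 0, of "2 *\<^sub>R u"] 3 ip_E_self[OF u]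
        by (simp add: ip_simps algebra_simps)
      then show False using Grefl[OF _ g, of "x - u"] xu[OF u 3] xy by simp
    qed
  qed
  show ?thesis
  proof (intro set_eqI iffI)
    fix \<alpha> assume a: "\<alpha> \<in> ?G"
    then have "\<alpha> \<in> C" unfolding gradient_iff by blast
    then show "\<alpha> \<in> D" using no_long a by (cases rule: C_cases) (auto simp: D_I)
  next
    fix \<alpha> assume "\<alpha> \<in> D"
    then show "\<alpha> \<in> ?G" unfolding D_iff using D_sub by blast
  qed
qed

text \<open>
  If \<open>u + v + t\<delta>\<close> and \<open>u - v + s\<delta>\<close> lie in \<open>\<Psi>\<close>, then \<open>t + s\<close> is odd, as otherwise their sum would be a
  long root of the affine system and so an element of \<open>\<Psi>\<close>. Consequently the parity of the
  \<open>\<delta>\<close>-coefficient is constant over each short root. The vector \<open>w\<close> is chosen to give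
  one member over each \<open>eps 1 - eps k\<close> offset 0; additivity then extends evenness of the offset
  to all of \<open>\<Psi>\<close>.
\<close>

lemma subset_even_part:
  assumes cl: "closed_subroot_system ip \<Phi> \<Psi>" and G: "gradient eps \<delta> n \<Psi> = D"
  obtains w where "half_odd w" "\<Psi> \<subseteq> even_part w"
proof -
  have \<Psi>\<Phi>: "\<Psi> \<subseteq> \<Phi>" using cl unfolding closed_subroot_system_def subroot_system_def by blast
  have sum: "\<alpha> + \<beta> \<in> \<Psi>" if "\<alpha> \<in> \<Psi>" "\<beta> \<in> \<Psi>" "\<alpha> + \<beta> \<in> \<Phi>" for \<alpha> \<beta>
    using cl that unfolding closed_subroot_system_def closed_in_roots_def by blast
  have neg: "- \<gamma> \<in> \<Psi>" if "\<gamma> \<in> \<Psi>" for \<gamma>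
  proof -
    have "\<gamma> \<in> \<Phi>" using \<Psi>\<Phi> that by blast
    then obtain \<alpha> t where a: "\<alpha> \<in> C" "\<gamma> = \<alpha> + of_int t *\<^sub>R \<delta>" by (rule Phi_lift)
    have "ip \<gamma> \<gamma> \<noteq> 0" using norm_C[OF a(1)] by (simp add: a(2) ip_simps)
    then show ?thesis
      using cl that reflect_self unfolding closed_subroot_system_def subroot_system_def by metis
  qed
  have no_long: "2 *\<^sub>R u + of_int t *\<^sub>R \<delta> \<notin> \<Psi>" if "u \<in> E" for u t
    using G long_in_C[OF that] D_not_L L_iff that unfolding gradient_def by blast
  have lift: "\<exists>t. u + v + of_int t *\<^sub>R \<delta> \<in> \<Psi>" if "u \<in> E" "v \<in> E" "ip u v = 0" for u v
    using G D_I[OF that] unfolding gradient_def by blast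
  have 1: "1 \<in> {1..n}" using n by simp
  define e where "e = eps 1"
  have e: "e \<in> E" unfolding e_def using E_eps 1 by blast
  have "\<exists>t. e - eps k + of_int t *\<^sub>R \<delta> \<in> \<Psi>" if "k \<in> {1..n} - {1}" for k
    using lift[OF e E_neg[OF E_eps[of k]]] that 1 unfolding e_def by (auto simp: ip_simps orthonormal)
  then obtain c where c: "\<And>k. k \<in> {1..n} - {1} \<Longrightarrow> e - eps k + of_int (c k) *\<^sub>R \<delta> \<in> \<Psi>"
    by metis
  \<comment> \<open>The offset of \<open>eps 1 - eps k + c k \<delta>\<close> is then \<open>c k - 1/2 + (1/2 - c k) = 0\<close>.\<close>
  define w where "w = (\<Sum>k\<in>{1..n}. (1 / 2 - (if k = 1 then 0 else of_int (c k))) *\<^sub>R eps k)"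
  have w_eps: "ip (eps k) w = 1 / 2 - (if k = 1 then 0 else of_int (c k))" if "k \<in> {1..n}" for k
    unfolding w_def by (rule ip_eps_sum[OF that])
  have w: "half_odd w" unfolding half_odd_def by (auto simp: w_eps)
  have pair: "(offset w (u + v + of_int t *\<^sub>R \<delta>) + offset w (u + - v + of_int s *\<^sub>R \<delta>)) / 2 \<in> \<int>"
    if u: "u \<in> E" "v \<in> E" and ts: "u + v + of_int t *\<^sub>R \<delta> \<in> \<Psi>" "u + - v + of_int s *\<^sub>R \<delta> \<in> \<Psi>"
    for u v t s
  proof -
    have eq: "(u + v + of_int t *\<^sub>R \<delta>) + (u + - v + of_int s *\<^sub>R \<delta>) = 2 *\<^sub>R u + of_int (t + s) *\<^sub>R \<delta>"
      by (simp add: algebra_simps scaleR_2)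
    have "odd (t + s)"
    proof
      assume "even (t + s)"
      then show False using sum[OF ts] long_in_Phi[OF u(1)] no_long[OF u(1)] unfolding eq by blast
    qed
    then show ?thesis using offset_long_odd[OF w u(1)] unfolding offset_add[symmetric] eq by blast
  qed
  have cancel: "a / 2 \<in> \<int>" if "b / 2 \<in> \<int>" "(a + b) / 2 \<in> \<int>" for a b :: real
    using Ints_diff[OF that(2,1)] by (simp add: add_divide_distrib)
  \<comment> \<open>The members over \<open>e - eps k\<close> and over \<open>e + eps k\<close> are compared pairwise, starting from the one of offset 0 over \<open>e - eps k\<close>.\<close>
  have base: "offset w (e + v + of_int t *\<^sub>R \<delta>) / 2 \<in> \<int>"
    if v: "v \<in> E" "ip e v = 0" and t: "e + v + of_int t *\<^sub>R \<delta> \<in> \<Psi>" for v t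
  proof -
    obtain k where k: "k \<in> {1..n}" "v = eps k \<or> v = - eps k" using v unfolding signed_units_def by auto
    then have k1: "k \<noteq> 1" using v(2) orthonormal[OF 1 1] unfolding e_def by (auto simp: ip_simps)
    have kE: "eps k \<in> E" using E_eps k by blast
    have ek: "ip e (eps k) = 0" unfolding e_def using orthonormal[OF 1 k(1)] k1 by simp
    have 0: "e + - eps k + of_int (c k) *\<^sub>R \<delta> \<in> \<Psi>" using c k k1 by simp
    have h0: "offset w (e + - eps k + of_int (c k) *\<^sub>R \<delta>) = 0"
      unfolding offset_short[OF e E_neg[OF kE]] using w_eps[OF 1] w_eps[OF k(1)] k1
      unfolding e_def by (simp add: ip_simps)
    have plus: "offset w (e + eps k + of_int t *\<^sub>R \<delta>) / 2 \<in> \<int>" if "e + eps k + of_int t *\<^sub>R \<delta> \<in> \<Psi>" for t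
      using pair[OF e kE that 0] h0 by simp
    show ?thesis
      using k(2)
    proof
      assume "v = eps k" then show ?thesis using plus t by simp
    next
      assume v': "v = - eps k"
      obtain s where s: "e + eps k + of_int s *\<^sub>R \<delta> \<in> \<Psi>" using lift[OF e kE ek] by blast
      show ?thesis using pair[OF e kE s t[unfolded v']] cancel[OF plus[OF s]] unfolding v' by (simp add: add.commute)
    qed
  qed
  have gen: "offset w (u + v + of_int t *\<^sub>R \<delta>) / 2 \<in> \<int>"
    if uv: "u \<in> E" "v \<in> E" "ip u v = 0" and t: "u + v + of_int t *\<^sub>R \<delta> \<in> \<Psi>" for u v t
  proof -
    have at_e: "offset w (u + v + of_int t *\<^sub>R \<delta>) / 2 \<in> \<int>"
      if uv: "u \<in> E" "v \<in> E" "ip u v = 0" and t: "u + v + of_int t *\<^sub>R \<delta> \<in> \<Psi>"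
        and u: "u = e \<or> u = - e" for u v t
      using u
    proof
      assume "u = e" then show ?thesis using base uv t by simp
    next
      assume u: "u = - e"
      have eq: "- (u + v + of_int t *\<^sub>R \<delta>) = e + - v + of_int (- t) *\<^sub>R \<delta>" unfolding u by simp
      have "ip e (- v) = 0" using uv(3) unfolding u by (simp add: ip_simps)
      then have "offset w (- (u + v + of_int t *\<^sub>R \<delta>)) / 2 \<in> \<int>"
        using base[OF E_neg[OF uv(2)]] neg[OF t] unfolding eq by blast
      then show ?thesis unfolding offset_neg by simp
    qed
    have vu: "ip v u = 0" using uv ip_sym by metis
    show ?thesis
    proof (cases "(u = e \<or> u = - e) \<or> v = e \<or> v = - e")
      case True
      then show ?thesis using at_e[OF uv t] at_e[OF uv(2,1) vu] t by (metis add.commute)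
    next
      case False
      then have "ip e u = 0" "ip e v = 0"
        using ip_E_cases[OF e uv(1)] ip_E_cases[OF e uv(2)] by metis+
      then have 0: "ip e u = 0" "ip e (- v) = 0" by (simp_all add: ip_simps)
      \<comment> \<open>Adding a member over \<open>e - v\<close> moves the root to one over \<open>e + u\<close>, where evenness is known.\<close>
      obtain s where s: "e + - v + of_int s *\<^sub>R \<delta> \<in> \<Psi>"
        using lift[OF e E_neg[OF uv(2)] 0(2)] by blast
      have eq: "(u + v + of_int t *\<^sub>R \<delta>) + (e + - v + of_int s *\<^sub>R \<delta>) = e + u + of_int (t + s) *\<^sub>R \<delta>"
        by (simp add: algebra_simps)
      have "e + u + of_int (t + s) *\<^sub>R \<delta> \<in> \<Psi>"
        using sum[OF t s] short_in_Phi[OF e uv(1) 0(1)] unfolding eq by blast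
      then have "offset w (e + u + of_int (t + s) *\<^sub>R \<delta>) / 2 \<in> \<int>" using base[OF uv(1) 0(1)] by blast
      then show ?thesis
        using cancel[OF base[OF E_neg[OF uv(2)] 0(2) s]] unfolding eq[symmetric] offset_add[of w "u + v + _"] by blast
    qed
  qed
  have "\<Psi> \<subseteq> even_part w"
  proof
    fix \<gamma> assume g: "\<gamma> \<in> \<Psi>"
    then have "\<gamma> \<in> \<Phi>" using \<Psi>\<Phi> by blast
    then show "\<gamma> \<in> even_part w"
    proof (cases rule: Phi_cases)
      case (short u v t)
      then show ?thesis using gen even_part_memI g by metis
    next
      case (long u t)
      then show ?thesis using no_long g by blast
    qed
  qed
  then show thesis using that w by blast
qed

section \<open>Irreducibility and affine type\<close>

text \<open>
  Over two short roots \<open>u + v\<close> and \<open>u + z\<close> with \<open>v\<close>, \<open>z\<close> orthogonal, any two members have inner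
  product 1 and cannot be separated. Connectedness of the orthogonal pairs does the rest.
\<close>

lemma even_part_irreducible:
  assumes w: "half_odd w" shows "irreducible_roots ip (even_part w)"
proof -
  have whole: "even_part w \<subseteq> A"
    if AB: "A \<union> B = even_part w" "\<forall>\<alpha>\<in>A. \<forall>\<beta>\<in>B. ip \<alpha> \<beta> = 0" and a: "a \<in> A" for A B a
  proof -
    define Q where "Q u v \<longleftrightarrow> (\<forall>t. u + v + of_int t *\<^sub>R \<delta> \<in> even_part w \<longrightarrow> u + v + of_int t *\<^sub>R \<delta> \<in> A)"
      for u v
    have spread: "Q u z"
      if E: "u \<in> E" "v \<in> E" "z \<in> E" "ip u v = 0" "ip u z = 0" "ip v z = 0"
        and t: "u + v + of_int t *\<^sub>R \<delta> \<in> A" for u v z t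
      unfolding Q_def
    proof (intro allI impI)
      fix s assume s: "u + z + of_int s *\<^sub>R \<delta> \<in> even_part w"
      have "ip (u + v + of_int t *\<^sub>R \<delta>) (u + z + of_int s *\<^sub>R \<delta>) = 1"
        using E ip_sym[of v u] by (simp add: ip_simps ip_E_self)
      then show "u + z + of_int s *\<^sub>R \<delta> \<in> A" using AB t s by fastforce
    qed
    obtain u v t where uv: "u \<in> E" "v \<in> E" "ip u v = 0" "a = u + v + of_int t *\<^sub>R \<delta>"
      using even_part_cases[OF w] a AB(1) by (metis UnI1)
    obtain z where z: "z \<in> E" "ip u z = 0" "ip v z = 0" using perp_third[OF uv(1,2)] by metis
    have start: "Q u z" by (rule spread[OF uv(1,2) z(1) uv(3) z(2,3) a[unfolded uv(4)]])
    have Q: "Q a b" if "a \<in> E" "b \<in> E" "ip a b = 0" for a b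
    proof (rule perp_pairs_connected[where Q = Q, OF _ _ uv(1) z(1,2) start that])
      show "Q v u" if "Q u v" for u v using that by (simp add: Q_def add.commute)
      show "Q u z" if E: "u \<in> E" "v \<in> E" "z \<in> E" "ip u v = 0" "ip u z = 0" "ip v z = 0"
        and q: "Q u v" for u v z
      proof -
        obtain t where "u + v + of_int t *\<^sub>R \<delta> \<in> even_part w"
          using even_part_lift[OF w E(1,2,4)] by metis
        then show ?thesis using spread[OF E] q unfolding Q_def by blast
      qed
    qed
    show ?thesis
    proof
      fix \<gamma> assume g: "\<gamma> \<in> even_part w"
      with w show "\<gamma> \<in> A" by (cases rule: even_part_cases) (use Q g in \<open>auto simp: Q_def\<close>)
    qed
  qed
  have "even_part w \<noteq> {}"
    using even_part_closed[OF w] unfolding closed_subroot_system_def subroot_system_def by blast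
  then show ?thesis
    unfolding irreducible_roots_def using whole by blast
qed

text \<open>
  The isomorphism subtracts the shift $(\alpha, w)$ from the coefficient of \<open>\<delta>\<close> and halves the
  result: \<open>\<alpha> + (p\<^sub>\<alpha> + 2r)\<delta>\<close> goes to \<open>\<alpha> + r\<delta>\<close>. It changes vectors only by multiples of \<open>\<delta>\<close>, so it
  preserves the form.
\<close>

lemma even_part_type:
  assumes w: "half_odd w"
  shows "has_type_of ip \<Phi> (even_part w) (D1_roots eps \<delta> n)"
proof -
  define f where "f x = x - ((d x + ip x w) / 2) *\<^sub>R \<delta>" for x
  \<comment> \<open>Moving along \<open>\<delta>\<close>, \<open>f\<close> halves \<open>d x + ip x w\<close> and \<open>g\<close> doubles it.\<close>
  define g where "g x = x + (d x + ip x w) *\<^sub>R \<delta>" for x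
  have lin: "linear f"
    by (rule linearI) (simp_all add: f_def d_simps ip_simps algebra_simps add_divide_distrib)
  have "f (g x) = x" for x
    by (simp add: f_def g_def d_simps ip_simps algebra_simps scaleR_add_left[symmetric] del: scaleR_add_left)
  moreover have "g (f x) = x" for x
    by (simp add: f_def g_def d_simps ip_simps algebra_simps add_divide_distrib)
  ultimately have bij: "bij f" by (metis bijI')
  have ipf: "ip (f x) (f y) = ip x y" for x y by (simp add: f_def ip_simps)
  have f_lift: "f (u + v + t *\<^sub>R \<delta>) = u + v + (offset w (u + v + t *\<^sub>R \<delta>) / 2) *\<^sub>R \<delta>"
    if "u \<in> E" "v \<in> E" for u v t
  proof -
    have "t - (t + (ip u w + ip v w)) / 2 = offset w (u + v + t *\<^sub>R \<delta>) / 2"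
      unfolding offset_short[OF that] by (simp add: field_simps)
    then show ?thesis
      unfolding f_def by (simp add: d_simps d_E that ip_simps scaleR_diff_left[symmetric] add.assoc del: scaleR_diff_left)
  qed
  have img: "f ` even_part w = D1_roots eps \<delta> n"
  proof (intro equalityI subsetI)
    fix \<eta> assume "\<eta> \<in> f ` even_part w"
    then obtain \<gamma> where \<gamma>: "\<gamma> \<in> even_part w" "\<eta> = f \<gamma>" by blast
    from w \<gamma>(1) show "\<eta> \<in> D1_roots eps \<delta> n"
    proof (cases rule: even_part_cases)
      case (1 u v t)
      obtain r where "offset w \<gamma> / 2 = of_int r" using 1(5) Ints_cases by metis
      then have "\<eta> = u + v + of_int r *\<^sub>R \<delta>" using f_lift[OF 1(1,2), of "of_int t"] \<gamma>(2) 1(4) by simp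
      then show ?thesis unfolding D1_roots_def using D_I[OF 1(1-3)] by blast
    qed
  next
    fix \<eta> assume "\<eta> \<in> D1_roots eps \<delta> n"
    then obtain u v r where uv: "u \<in> E" "v \<in> E" "ip u v = 0" "\<eta> = u + v + of_int r *\<^sub>R \<delta>"
      unfolding D1_roots_def D_iff by blast
    obtain m :: int where m: "ip u w + ip v w = of_int m" using half_odd_ip_short w uv by metis
    have h: "offset w (u + v + of_int (2 * r + m) *\<^sub>R \<delta>) = 2 * of_int r"
      unfolding offset_short[OF uv(1,2)] using m by simp
    have "u + v + of_int (2 * r + m) *\<^sub>R \<delta> \<in> even_part w"
      by (rule even_part_memI[OF uv(1-3)]) (simp only: h, simp)
    moreover have "f (u + v + of_int (2 * r + m) *\<^sub>R \<delta>) = \<eta>"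
      unfolding f_lift[OF uv(1,2)] h uv(4) by simp
    ultimately show "\<eta> \<in> f ` even_part w" by blast
  qed
  have "bij_betw f (span (even_part w)) (span (D1_roots eps \<delta> n))"
    unfolding img[symmetric] linear_span_image[OF lin]
    by (intro bij_betw_imageI refl inj_on_subset[OF bij_is_inj[OF bij]]) simp
  moreover have "subroot_system ip \<Phi> (even_part w)"
    using even_part_closed[OF w] unfolding closed_subroot_system_def by blast
  ultimately show ?thesis
    unfolding has_type_of_def using lin img even_part_irreducible[OF w] ipf
    by (intro conjI exI[of _ f]) (auto simp: pairing_def)
qed

section \<open>Linear functions and dual vectors\<close>

lemma Psi_p_eq_even_part:
  assumes "\<And>\<alpha>. \<alpha> \<in> D \<Longrightarrow> of_int (p \<alpha>) = ip \<alpha> w" and w: "half_odd w"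
  shows "Psi_p eps \<delta> n p = even_part w"
proof (intro equalityI subsetI)
  fix \<gamma> assume "\<gamma> \<in> Psi_p eps \<delta> n p"
  then obtain u v r where uv: "u \<in> E" "v \<in> E" "ip u v = 0"
      "\<gamma> = u + v + of_int (p (u + v) + 2 * r) *\<^sub>R \<delta>"
    unfolding Psi_p_def D_iff by blast
  have "of_int (p (u + v)) = ip u w + ip v w" using assms(1)[OF D_I[OF uv(1-3)]] by (simp add: ip_simps)
  then have h: "offset w (u + v + of_int (p (u + v) + 2 * r) *\<^sub>R \<delta>) = 2 * of_int r"
    unfolding offset_short[OF uv(1,2)] by simp
  show "\<gamma> \<in> even_part w"
    unfolding uv(4) by (rule even_part_memI[OF uv(1-3)]) (simp only: h, simp)
next
  fix \<gamma> assume "\<gamma> \<in> even_part w"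
  with w show "\<gamma> \<in> Psi_p eps \<delta> n p"
  proof (cases rule: even_part_cases)
    case (1 u v t)
    obtain r where r: "offset w \<gamma> / 2 = of_int r" using 1(5) Ints_cases by metis
    have "of_int (p (u + v)) = ip u w + ip v w" using assms(1)[OF D_I[OF 1(1-3)]] by (simp add: ip_simps)
    then have "real_of_int t = of_int (p (u + v) + 2 * r)"
      using r unfolding 1(4) offset_short[OF 1(1,2)] by simp
    then show ?thesis unfolding Psi_p_def 1(4) of_int_eq_iff using D_I[OF 1(1-3)] by blast
  qed
qed

text \<open>
  The lattice spanned by the short roots contains each \<open>2 eps k\<close>, so the additive
  function extends to half-integral values on the \<open>eps k\<close>, which are the coordinates of \<open>w\<close>.
\<close>

lemma Z_linear_parity_dual_vector:
  assumes "Z_linear eps n p" "parity_condition eps n p"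
  obtains w where "half_odd w" "\<And>\<alpha>. \<alpha> \<in> D \<Longrightarrow> of_int (p \<alpha>) = ip \<alpha> w"
proof -
  let ?Q = "group_closure D"
  obtain f where f: "\<And>x y. x \<in> ?Q \<Longrightarrow> y \<in> ?Q \<Longrightarrow> f (x + y) = f x + f y"
    and p: "\<And>\<alpha>. \<alpha> \<in> D \<Longrightarrow> p \<alpha> = f \<alpha>"
    using assms(1) unfolding Z_linear_def by blast
  have DQ: "\<alpha> \<in> ?Q" if "\<alpha> \<in> D" for \<alpha> using that by (simp add: group_closure.base)
  define w where "w = (\<Sum>k\<in>{1..n}. (of_int (f (2 *\<^sub>R eps k)) / 2) *\<^sub>R eps k)"
  have w_eps: "ip (eps k) w = of_int (f (2 *\<^sub>R eps k)) / 2" if "k \<in> {1..n}" for k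
    unfolding w_def by (rule ip_eps_sum[OF that])
  have twoQ: "2 *\<^sub>R u \<in> ?Q" and two_f: "f (2 *\<^sub>R u) = f (u + v) + f (u + - v)"
    if u: "u \<in> E" "v \<in> E" "ip u v = 0" for u v
  proof -
    have "ip u (- v) = 0" using u by (simp add: ip_simps)
    then have q: "u + v \<in> ?Q" "u + - v \<in> ?Q" using DQ D_I u E_neg by blast+
    have eq: "(u + v) + (u + - v) = 2 *\<^sub>R u" by (simp add: scaleR_2)
    show "2 *\<^sub>R u \<in> ?Q" using group_closure_add[OF q] unfolding eq .
    show "f (2 *\<^sub>R u) = f (u + v) + f (u + - v)" using f[OF q] unfolding eq .
  qed
  have EQ: "2 *\<^sub>R u \<in> ?Q" if "u \<in> E" for u
    using perp_third[OF that that] twoQ[OF that] by metis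
  have f0: "f 0 = 0" using f[of 0 0] by simp
  have fneg: "f (- x) = - f x" if "x \<in> ?Q" for x using f[of x "- x"] that f0 by simp
  have w_E: "of_int (f (2 *\<^sub>R u)) = 2 * ip u w" if u: "u \<in> E" for u
  proof -
    obtain i where i: "i \<in> {1..n}" "u = eps i \<or> u = - eps i" using u unfolding signed_units_def by auto
    show ?thesis
      using i(2)
    proof
      assume "u = eps i" then show ?thesis using w_eps[OF i(1)] by simp
    next
      assume u: "u = - eps i"
      show ?thesis
        using w_eps[OF i(1)] fneg[OF EQ[OF E_eps[OF i(1)]]] unfolding u by (simp add: ip_simps)
    qed
  qed
  have "of_int (p \<alpha>) = ip \<alpha> w" if \<alpha>: "\<alpha> \<in> D" for \<alpha>
  proof -
    obtain u v where uv: "u \<in> E" "v \<in> E" "ip u v = 0" "\<alpha> = u + v" using \<alpha> unfolding D_iff by blast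
    have "2 * f \<alpha> = f (\<alpha> + \<alpha>)" using f DQ[OF \<alpha>] by simp
    also have "\<alpha> + \<alpha> = 2 *\<^sub>R u + 2 *\<^sub>R v" unfolding uv(4) by (simp add: scaleR_2)
    also have "f \<dots> = f (2 *\<^sub>R u) + f (2 *\<^sub>R v)" using f EQ uv by blast
    finally have "of_int (2 * f \<alpha>) = 2 * ip u w + 2 * ip v w"
      using w_E[OF uv(1)] w_E[OF uv(2)] by simp
    then show ?thesis using p[OF \<alpha>] uv(4) by (simp add: ip_simps)
  qed
  moreover have "half_odd w"
    unfolding half_odd_def
  proof
    fix i assume i: "i \<in> {1..n}"
    obtain j where j: "j \<in> {1..n}" "j \<noteq> i" by (rule that[of "if i = 1 then 2 else 1"]) (use n in auto)
    have 0: "ip (eps i) (eps j) = 0" using i j orthonormal by auto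
    have E: "eps i \<in> E" "eps j \<in> E" using E_eps i j by blast+
    have "eps i + - eps j \<in> D" "eps i + eps j \<in> D"
      using D_I[OF E 0] D_I[OF E(1) E_neg[OF E(2)]] 0 by (simp_all add: ip_simps)
    then have "even (f (eps i - eps j)) \<noteq> even (f (eps i + eps j))"
      using assms(2) i j p unfolding parity_condition_def by (metis diff_conv_add_uminus)
    then have "odd (f (2 *\<^sub>R eps i))" using two_f[OF E 0] by simp
    then obtain m where "f (2 *\<^sub>R eps i) = 2 * m + 1" by (elim oddE)
    then show "ip (eps i) w - 1 / 2 \<in> \<int>" using w_eps[OF i] by (simp add: add_divide_distrib)
  qed
  ultimately show thesis using that by blast
qed

lemma dual_vector_Z_linear_parity:
  assumes w: "half_odd w"
  obtains p where "Z_linear eps n p" "parity_condition eps n p"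
    "\<And>\<alpha>. \<alpha> \<in> D \<Longrightarrow> of_int (p \<alpha>) = ip \<alpha> w"
proof -
  \<comment> \<open>The floor only supplies integer values; on the root lattice \<open>ip x w\<close> is already an integer.\<close>
  define p where "p \<alpha> = \<lfloor>ip \<alpha> w\<rfloor>" for \<alpha>
  have D_int: "ip \<alpha> w \<in> \<int>" if \<alpha>: "\<alpha> \<in> D" for \<alpha>
  proof -
    obtain u v where uv: "u \<in> E" "v \<in> E" "\<alpha> = u + v" using \<alpha> unfolding D_iff by blast
    obtain m :: int where "ip u w + ip v w = of_int m" using half_odd_ip_short[OF w uv(1,2)] by metis
    then show ?thesis unfolding uv(3) by (simp add: ip_simps)
  qed
  have Q_int: "ip x w \<in> \<int>" if "x \<in> group_closure D" for x
    using that by induction (auto simp: D_int ip_simps)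
  have p: "of_int (p x) = ip x w" if "x \<in> group_closure D" for x
    using Q_int[OF that] unfolding p_def by (auto elim: Ints_cases)
  have pD: "of_int (p \<alpha>) = ip \<alpha> w" if "\<alpha> \<in> D" for \<alpha>
    using p that by (simp add: group_closure.base)
  have "Z_linear eps n p"
    unfolding Z_linear_def
  proof (intro exI[of _ p] conjI ballI)
    fix x y assume xy: "x \<in> group_closure D" "y \<in> group_closure D"
    have "real_of_int (p (x + y)) = of_int (p x + p y)"
      using p[OF xy(1)] p[OF xy(2)] p[OF group_closure_add[OF xy]] by (simp add: ip_simps)
    then show "p (x + y) = p x + p y" by (simp only: of_int_eq_iff)
  qed simp
  moreover have "parity_condition eps n p"
    unfolding parity_condition_def
  proof (intro ballI impI)
    fix s t assume st: "s \<in> {1..n}" "t \<in> {1..n}" "s \<noteq> t"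
    have 0: "ip (eps s) (eps t) = 0" using st orthonormal by auto
    have E: "eps s \<in> E" "eps t \<in> E" using E_eps st by blast+
    have D: "eps s - eps t \<in> D" "eps s + eps t \<in> D"
      using D_I[OF E 0] D_I[OF E(1) E_neg[OF E(2)]] 0 by (simp_all add: ip_simps)
    obtain m :: int where m: "ip (eps s) w = of_int m + 1 / 2" using half_odd_E[OF w E(1)] by metis
    have "real_of_int (p (eps s - eps t) + p (eps s + eps t)) = of_int (2 * m + 1)"
      using pD[OF D(1)] pD[OF D(2)] m by (simp add: ip_simps)
    then have "p (eps s - eps t) + p (eps s + eps t) = 2 * m + 1" by (simp only: of_int_eq_iff)
    then have "odd (p (eps s - eps t) + p (eps s + eps t))" by simp
    then show "even (p (eps s - eps t)) \<noteq> even (p (eps s + eps t))" by auto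
  qed
  ultimately show thesis using that pD by blast
qed

section \<open>The classification\<close>

lemma maximal_semi_closed_iff:
  "maximal_closed_subroot_system ip \<Phi> \<Psi> \<and> gradient eps \<delta> n \<Psi> \<noteq> C \<and>
     semi_closed ip eps n (gradient eps \<delta> n \<Psi>)
   \<longleftrightarrow> (\<exists>w. half_odd w \<and> \<Psi> = even_part w)"
proof
  assume a: "maximal_closed_subroot_system ip \<Phi> \<Psi> \<and> gradient eps \<delta> n \<Psi> \<noteq> C \<and>
     semi_closed ip eps n (gradient eps \<delta> n \<Psi>)"
  then have "closed_subroot_system ip \<Phi> \<Psi>" unfolding maximal_closed_subroot_system_def by blast
  then obtain w where w: "half_odd w" "\<Psi> \<subseteq> even_part w"
    using subset_even_part gradient_is_D a by metis
  have "even_part w \<subset> \<Phi>" using even_part_proper[OF w(1)] unfolding even_part_def by blast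
  then have "even_part w = \<Psi>"
    using a w(2) even_part_closed[OF w(1)] unfolding maximal_closed_subroot_system_def by blast
  then show "\<exists>w. half_odd w \<and> \<Psi> = even_part w" using w(1) by blast
qed (use even_part_maximal gradient_even_part D_semi_closed D_proper in auto)

lemma ex_Psi_p_iff:
  "(\<exists>p. Z_linear eps n p \<and> parity_condition eps n p \<and> \<Psi> = Psi_p eps \<delta> n p)
   \<longleftrightarrow> (\<exists>w. half_odd w \<and> \<Psi> = even_part w)"
proof
  assume "\<exists>p. Z_linear eps n p \<and> parity_condition eps n p \<and> \<Psi> = Psi_p eps \<delta> n p"
  then obtain p where p: "Z_linear eps n p" "parity_condition eps n p" "\<Psi> = Psi_p eps \<delta> n p"
    by blast
  then show "\<exists>w. half_odd w \<and> \<Psi> = even_part w"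
    using Z_linear_parity_dual_vector[OF p(1,2)] Psi_p_eq_even_part by metis
next
  assume "\<exists>w. half_odd w \<and> \<Psi> = even_part w"
  then obtain w where w: "half_odd w" "\<Psi> = even_part w" by blast
  obtain p where p: "Z_linear eps n p" "parity_condition eps n p" "\<And>\<alpha>. \<alpha> \<in> D \<Longrightarrow> of_int (p \<alpha>) = ip \<alpha> w"
    using dual_vector_Z_linear_parity[OF w(1)] by blast
  then show "\<exists>p. Z_linear eps n p \<and> parity_condition eps n p \<and> \<Psi> = Psi_p eps \<delta> n p"
    using Psi_p_eq_even_part[OF p(3) w(1)] w(2) by blast
qed

end

lemma separating_functional:
  fixes \<delta> :: "'v::real_vector"
  assumes "\<delta> \<notin> span S"
  obtains d :: "'v \<Rightarrow> real" where "linear d" "d \<delta> = 1" "\<forall>x\<in>S. d x = 0"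
proof -
  obtain B where B: "B \<subseteq> S" "independent B" "S \<subseteq> span B"
    using maximal_independent_subset by metis
  have nB: "\<delta> \<notin> span B" using assms B(1) span_mono by blast
  then have "independent (insert \<delta> B)" using B(2) by (rule independent_insertI)
  then obtain d where d: "linear d" "\<forall>x\<in>insert \<delta> B. d x = (if x = \<delta> then 1 else 0 :: real)"
    using linear_independent_extend[of "insert \<delta> B" "\<lambda>x. if x = \<delta> then 1 else 0 :: real"] by blast
  have "d x = 0" if "x \<in> B" for x
  proof -
    have "x \<noteq> \<delta>" using that nB span_base by blast
    then show ?thesis using d(2) that by simp
  qed
  then have "d x = 0" if "x \<in> span B" for x using linear_eq_0_on_span[OF d(1) _ that] by blast
  then have "d x = 0" if "x \<in> S" for x using B(3) that by blast
  moreover have "d \<delta> = 1" using d(2) by simp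
  ultimately show thesis using that[OF d(1)] by blast
qed

theorem proposition7p1p2:
  fixes ip :: "'v::real_vector \<Rightarrow> 'v \<Rightarrow> real"
    and eps :: "nat \<Rightarrow> 'v" and \<delta> :: 'v and n :: nat
  assumes n: "n \<ge> 3"
    and ip_bilinear: "bilinear ip"
    and ip_sym: "\<And>x y. ip x y = ip y x"
    and orthonormal:
      "\<And>i j. i \<in> {1..n} \<Longrightarrow> j \<in> {1..n} \<Longrightarrow> ip (eps i) (eps j) = (if i = j then 1 else 0)"
    and delta_indep: "\<delta> \<notin> span (eps ` {1..n})"
    and delta_isotropic: "\<And>x. ip \<delta> x = 0"
  shows "(\<forall>\<Psi>. \<Psi> \<subseteq> A2_roots eps \<delta> n \<longrightarrow>
            (maximal_closed_subroot_system ip (A2_roots eps \<delta> n) \<Psi> \<and>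
             gradient eps \<delta> n \<Psi> \<noteq> C_roots eps n \<and>
             semi_closed ip eps n (gradient eps \<delta> n \<Psi>)
             \<longleftrightarrow>
             (\<exists>p. Z_linear eps n p \<and> parity_condition eps n p \<and> \<Psi> = Psi_p eps \<delta> n p))) \<and>
         (\<forall>p. Z_linear eps n p \<and> parity_condition eps n p \<longrightarrow>
            has_type_of ip (A2_roots eps \<delta> n) (Psi_p eps \<delta> n p) (D1_roots eps \<delta> n))"
proof -
  obtain d :: "'v \<Rightarrow> real" where d: "linear d" "d \<delta> = 1" "\<forall>x\<in>eps ` {1..n}. d x = 0"
    by (rule separating_functional[OF delta_indep]) blast
  interpret affine_C_frame ip eps \<delta> n d
    by (intro affine_C_frame.intro n ip_bilinear ip_sym orthonormal delta_isotropic d(1,2)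
        bspec[OF d(3)] imageI)
  have type: "has_type_of ip (A2_roots eps \<delta> n) (Psi_p eps \<delta> n p) (D1_roots eps \<delta> n)"
    if p: "Z_linear eps n p \<and> parity_condition eps n p" for p
  proof -
    have "\<exists>w. half_odd w \<and> Psi_p eps \<delta> n p = even_part w"
      by (rule iffD1[OF ex_Psi_p_iff]) (intro exI[of _ p] conjI conjunct1[OF p] conjunct2[OF p] refl)
    then obtain w where w: "half_odd w" "Psi_p eps \<delta> n p = even_part w" by (elim exE conjE)
    show ?thesis unfolding w(2) by (rule even_part_type[OF w(1)])
  qed
  show ?thesis
    by (intro conjI allI impI trans[OF maximal_semi_closed_iff ex_Psi_p_iff[symmetric]])
      (rule type)
qed

end
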